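(* Let $\underline\Omega\subset\mathbb R^m$ be an open and connected set and let $A_0,A_1:\underline\Omega\to\mathbb R_{0,m}$ be (real) analytic functions in $\underline\Omega$. Then there is an $x_0$-normal open neighbourhood $\widetilde\Omega$ of $\underline\Omega$ in $\mathbb R^{m+1}$ such that the function $\mathsf{CK}[A_0,A_1]$ given by the series $$\mathsf{CK}[A_0,A_1](x)=A_0(\underline x)+x_0A_1(\underline x)-\sum_{n=2}^\infty\frac{(-x_0)^n}{n!}\left(\sum_{j=0}^{n-2}\partial_{\underline x}^{\,n-j-1}A_0(\underline x)\,\partial_{\underline x}^{\,j+1}+\sum_{j=0}^{n-1}\partial_{\underline x}^{\,n-j-1}A_1(\underline x)\,\partial_{\underline x}^{\,j}\right)$$ is inframonogenic in $\widetilde\Omega$ and satisfies, on $\underline\Omega$, $$\mathsf{CK}[A_0,A_1](x)\big\vert_{x_0=0}=A_0(\underline x),\qquad \partial_{x_0}\mathsf{CK}[A_0,A_1](x)\big\vert_{x_0=0}=A_1(\underline x).$$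
   Context: $\mathbb R_{0,m}$ is the $2^m$-dimensional real Clifford algebra (associative, with unit) constructed over the orthonormal basis $(e_1,\dots,e_m)$ of $\mathbb R^m$, with multiplication determined by $e_je_k+e_ke_j=-2\delta_{jk}$, $j,k=1,\dots,m$. A general element is $a=\sum_A a_Ae_A$ with $a_A\in\mathbb R$, where for $A=\{j_1,\dots,j_k\}\subset\{1,\dots,m\}$, $j_1<\cdots<j_k$, one puts $e_A=e_{j_1}\cdots e_{j_k}$, and $e_\emptyset=1$. Its norm is given by $|a|^2=\sum_A a_A^2$. An $\mathbb R_{0,m}$-valued function is analytic (or $C^k$) if its real components are. A point $(x_0,x_1,\dots,x_m)\in\mathbb R^{m+1}$ is identified with the paravector $x=x_0+\underline x$, $\underline x=\sum_{j=1}^m x_je_j$; the set $\underline\Omega\subset\mathbb R^m$ is regarded as the subset $\{0\}\times\underline\Omega$ of $\mathbb R^{m+1}$. The operators are $\partial_{\underline x}=\sum_{j=1}^m e_j\partial_{x_j}$ and $\partial_x=\partial_{x_0}+\partial_{\underline x}$. They act from the left or from the right according to the side on which they are written: $\partial_{\underline x}f=\sum_{j=1}^m e_j\,(\partial_{x_j}f)$ and $f\partial_{\underline x}=\sum_{j=1}^m(\partial_{x_j}f)\,e_j$, while $\partial_xf=\partial_{x_0}f+\partial_{\underline x}f$ and $f\partial_x=\partial_{x_0}f+f\partial_{\underline x}$. Thus $\partial_{\underline x}^{\,p}f\,\partial_{\underline x}^{\,q}$ means that $\partial_{\underline x}$ is applied $p$ times from the left and $q$ times from the right (a zeroth power meaning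 no action); left and right actions commute on sufficiently smooth functions. Inframonogenic: for an open set $\Omega\subset\mathbb R^{m+1}$, a function $f\in C^2(\Omega)$ with values in $\mathbb R_{0,m}$ is inframonogenic in $\Omega$ if $\partial_xf\partial_x=0$ in $\Omega$. $x_0$-normal open neighbourhood: an open set $\widetilde\Omega\subset\mathbb R^{m+1}$ containing $\underline\Omega$ is an $x_0$-normal open neighbourhood of $\underline\Omega$ in $\mathbb R^{m+1}$ if for each $x\in\widetilde\Omega$ the line segment $\{x+t:\ t\in\mathbb R\}\cap\widetilde\Omega$ (where $t\in\mathbb R$ is added to the $x_0$-coordinate) is connected and contains one point in $\underline\Omega$. *)

theory Defs
  imports "HOL-Analysis.Analysis"
begin

text \<open>
  The dimension $m$ is the cardinality of a finite, linearly ordered index type \<open>'m\<close>.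
  An element $a = \sum_A a_A e_A$ is the vector of its $2^m$ coefficients, so the Euclidean norm
  of the type is the Clifford norm.  Beware that \<open>*\<close> and \<open>1\<close> on this type are the componentwise
  operations of \<^theory>\<open>HOL-Analysis.Finite_Cartesian_Product\<close>; the Clifford product and unit
  are \<open>\<odot>\<close> and \<open>blade {}\<close>.
\<close>

type_synonym 'm clifford = "real ^ ('m set)"

definition blade :: "'m::finite set \<Rightarrow> 'm clifford" where
  "blade A = axis A 1"

text \<open>
  \<open>blade A \<odot> blade B = blade_sign A B *\<^sub>R blade (sym_diff A B)\<close>: sorting
  $e_A e_B$ gives one factor $-1$ for each pair $b < a$ (anticommutation) and one for each pair
  $b = a$ (from $e_a^2 = -1$).
\<close>

definition blade_sign :: "'m::{finite,linorder} set \<Rightarrow> 'm set \<Rightarrow> real" where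
  "blade_sign A B = (- 1) ^ card {(a, b). a \<in> A \<and> b \<in> B \<and> b \<le> a}"

definition clifford_mult ::
    "'m::{finite,linorder} clifford \<Rightarrow> 'm clifford \<Rightarrow> 'm clifford"  (infixl "\<odot>" 70) where
  "a \<odot> b = (\<Sum>A\<in>UNIV. \<Sum>B\<in>UNIV. (a $ A * b $ B * blade_sign A B) *\<^sub>R blade (sym_diff A B))"

abbreviation gen :: "'m::finite \<Rightarrow> 'm clifford" where
  "gen j \<equiv> blade {j}"

text \<open>
  The following facts show that this is the algebra generated by the $e_j$ subject to
  $e_j e_k + e_k e_j = -2 \delta_{jk}$, with $e_A$ the product of the $e_j$, $j \in A$, in
  increasing order.
\<close>

lemma clifford_expansion: "(a :: 'm::finite clifford) = (\<Sum>A\<in>UNIV. a $ A *\<^sub>R blade A)"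
  by (simp add: vec_eq_iff blade_def axis_def if_distrib cong: if_cong)

lemma bilinear_clifford_mult:
  "bilinear (clifford_mult :: 'm::{finite,linorder} clifford \<Rightarrow> _)"
  unfolding bilinear_def clifford_mult_def
  by (auto intro!: linearI simp: algebra_simps sum.distrib scaleR_sum_right)

lemma blade_mult: "blade A \<odot> blade B = blade_sign A B *\<^sub>R blade (sym_diff A B)"
proof -
  have "blade A \<odot> blade B = (\<Sum>A'\<in>UNIV. \<Sum>B'\<in>UNIV.
      if A' = A then if B' = B then blade_sign A B *\<^sub>R blade (sym_diff A B) else 0 else 0)"
    unfolding clifford_mult_def
    by (intro sum.cong refl) (auto simp: blade_def axis_def)
  also have "\<dots> = (\<Sum>A'\<in>UNIV. if A' = A then (\<Sum>B'\<in>UNIV.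
      if B' = B then blade_sign A B *\<^sub>R blade (sym_diff A B) else 0) else 0)"
    by (intro sum.cong refl) auto
  finally show ?thesis
    by simp
qed

lemma blade_sign_prod:
  "blade_sign A B = (\<Prod>a\<in>A. \<Prod>b\<in>B. if b \<le> a then - 1 else 1)"
proof -
  have "(\<Prod>a\<in>A. \<Prod>b\<in>B. if b \<le> a then - 1 else (1::real)) =
      (\<Prod>p\<in>A \<times> B. if snd p \<le> fst p then - 1 else 1)"
    by (simp add: prod.cartesian_product case_prod_beta)
  also have "\<dots> = (\<Prod>p\<in>{p \<in> A \<times> B. snd p \<le> fst p}. - 1)"
    by (rule prod.inter_filter[symmetric]) simp
  also have "{p \<in> A \<times> B. snd p \<le> fst p} = {(a, b). a \<in> A \<and> b \<in> B \<and> b \<le> a}"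
    by auto
  finally show ?thesis
    by (simp add: blade_sign_def)
qed

lemma prod_sym_diff:
  fixes f :: "'a::finite \<Rightarrow> real"
  assumes "\<And>x. f x * f x = 1"
  shows "prod f (sym_diff A B) = prod f A * prod f B"
proof -
  have A: "prod f A = prod f (A - B) * prod f (A \<inter> B)"
    by (subst prod.union_disjoint[symmetric]) (auto intro!: prod.cong)
  have B: "prod f B = prod f (B - A) * prod f (A \<inter> B)"
    by (subst prod.union_disjoint[symmetric]) (auto intro!: prod.cong)
  have "prod f (A \<inter> B) * prod f (A \<inter> B) = 1"
    by (simp add: prod.distrib[symmetric] assms)
  then have "prod f A * prod f B = prod f (A - B) * prod f (B - A)"
    unfolding A B by (metis (no_types, lifting) mult.assoc mult.commute mult.right_neutral)
  also have "\<dots> = prod f (sym_diff A B)"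
    by (subst prod.union_disjoint) auto
  finally show ?thesis ..
qed

lemma blade_sign_sym_diff_left:
  "blade_sign (sym_diff A B) C = blade_sign A C * blade_sign B C"
  unfolding blade_sign_prod
  by (rule prod_sym_diff) (auto simp: prod.distrib[symmetric] intro!: prod.neutral)

lemma blade_sign_sym_diff_right:
  "blade_sign A (sym_diff B C) = blade_sign A B * blade_sign A C"
  unfolding blade_sign_prod prod.distrib[symmetric]
  by (intro prod.cong refl prod_sym_diff) simp

lemma blade_mult_assoc: "(blade A \<odot> blade B) \<odot> blade C = blade A \<odot> (blade B \<odot> blade C)"
proof -
  have "sym_diff (sym_diff A B) C = sym_diff A (sym_diff B C)"
    by auto
  then show ?thesis
    by (simp only: blade_mult bilinear_lmul[OF bilinear_clifford_mult]
        bilinear_rmul[OF bilinear_clifford_mult] blade_sign_sym_diff_left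
        blade_sign_sym_diff_right scaleR_scaleR mult_ac)
qed

lemma clifford_mult_assoc: "(a \<odot> b) \<odot> c = a \<odot> (b \<odot> c)"
proof -
  note bl = bilinear_clifford_mult
  note lin = bilinear_lmul[OF bl] bilinear_rmul[OF bl]
    linear_sum[OF bilinear_clifford_mult[unfolded bilinear_def, THEN conjunct1, rule_format]]
    linear_sum[OF bilinear_clifford_mult[unfolded bilinear_def, THEN conjunct2, rule_format]]
  have 1: "(blade A \<odot> blade B) \<odot> c = blade A \<odot> (blade B \<odot> c)" for A B
    by (subst (1 2) clifford_expansion[of c]) (simp only: lin blade_mult_assoc)
  have 2: "(blade A \<odot> b) \<odot> c = blade A \<odot> (b \<odot> c)" for A
    by (subst (1 2) clifford_expansion[of b]) (simp only: lin 1)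
  show ?thesis
    by (subst (1 2) clifford_expansion[of a]) (simp only: lin 2)
qed

lemma clifford_mult_unit: "blade {} \<odot> a = a" "a \<odot> blade {} = a"
proof -
  note bl = bilinear_clifford_mult
  note lin = bilinear_lmul[OF bl] bilinear_rmul[OF bl]
    linear_sum[OF bilinear_clifford_mult[unfolded bilinear_def, THEN conjunct1, rule_format]]
    linear_sum[OF bilinear_clifford_mult[unfolded bilinear_def, THEN conjunct2, rule_format]]
  have *: "blade {} \<odot> blade A = blade A" "blade A \<odot> blade {} = blade A" for A
    by (simp_all add: blade_mult blade_sign_prod)
  show "blade {} \<odot> a = a"
    by (subst (2) clifford_expansion[of a], subst clifford_expansion[of a]) (simp only: lin *)
  show "a \<odot> blade {} = a"
    by (subst (2) clifford_expansion[of a], subst clifford_expansion[of a]) (simp only: lin *)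
qed

lemma gen_anticommute:
  "gen j \<odot> gen k + gen k \<odot> gen j = (if j = k then - 2 else 0) *\<^sub>R blade {}"
proof (cases "j = k")
  case True
  then show ?thesis
    by (simp add: blade_mult blade_sign_prod scaleR_2[symmetric] del: scaleR_2)
next
  case False
  then have "sym_diff {j} {k} = sym_diff {k} {j}"
    by auto
  with False show ?thesis
    by (auto simp: blade_mult blade_sign_prod)
qed

lemma blade_eq_prod_gen:
  "blade A = foldr (\<lambda>j a. gen j \<odot> a) (sorted_list_of_set A) (blade {})"
proof (induction A rule: finite_linorder_min_induct[OF finite])
  case 1
  then show ?case by simp
next
  case (2 j A)
  then have "sorted_list_of_set (insert j A) = j # sorted_list_of_set A"
    by (subst sorted_list_of_set_insert)
       (auto intro!: insort_is_Cons simp: less_imp_le)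
  moreover have "gen j \<odot> blade A = blade (insert j A)"
  proof -
    have "(\<Prod>b\<in>A. if b \<le> j then - 1 else (1::real)) = 1"
      using 2 by (intro prod.neutral) auto
    moreover have "sym_diff {j} A = insert j A"
      using 2 by auto
    ultimately show ?thesis
      by (simp add: blade_mult blade_sign_prod)
  qed
  ultimately show ?case
    using 2 by simp
qed

text \<open>
  The directional derivative; its value is unspecified where the derivative does not exist, so
  \<open>Ck_on\<close> asks for existence separately.  At points of an open set it depends only on the values
  of the function on that set.
\<close>

definition partial ::
    "'a::real_normed_vector \<Rightarrow> ('a \<Rightarrow> 'b::real_normed_vector) \<Rightarrow> 'a \<Rightarrow> 'b" where
  "partial v f x = vector_derivative (\<lambda>t. f (x + t *\<^sub>R v)) (at 0)"

primrec Ck_on :: "nat \<Rightarrow> ('a::euclidean_space \<Rightarrow> real) \<Rightarrow> 'a set \<Rightarrow> bool" where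
  "Ck_on 0 f S \<longleftrightarrow> continuous_on S f"
| "Ck_on (Suc k) f S \<longleftrightarrow> continuous_on S f \<and>
     (\<forall>v\<in>Basis. (\<forall>x\<in>S. (\<lambda>t. f (x + t *\<^sub>R v)) differentiable (at 0)) \<and> Ck_on k (partial v f) S)"

definition clifford_Ck_on ::
    "nat \<Rightarrow> ('a::euclidean_space \<Rightarrow> 'm::finite clifford) \<Rightarrow> 'a set \<Rightarrow> bool" where
  "clifford_Ck_on k f S \<longleftrightarrow> (\<forall>A. Ck_on k (\<lambda>x. f x $ A) S)"

text \<open>Power series are indexed by multi-indices \<open>\<alpha> :: 'n \<Rightarrow> nat\<close>.\<close>

definition real_analytic_on :: "(real ^ 'n::finite \<Rightarrow> real) \<Rightarrow> (real ^ 'n) set \<Rightarrow> bool" where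
  "real_analytic_on f S \<longleftrightarrow> (\<forall>a\<in>S. \<exists>r>0. \<exists>c :: ('n \<Rightarrow> nat) \<Rightarrow> real. \<forall>x\<in>ball a r.
     ((\<lambda>\<alpha>. c \<alpha> * (\<Prod>i\<in>UNIV. (x $ i - a $ i) ^ \<alpha> i)) has_sum f x) UNIV)"

definition clifford_analytic_on ::
    "(real ^ 'n::finite \<Rightarrow> 'm::finite clifford) \<Rightarrow> (real ^ 'n) set \<Rightarrow> bool" where
  "clifford_analytic_on f S \<longleftrightarrow> (\<forall>A. real_analytic_on (\<lambda>x. f x $ A) S)"

text \<open>The first component of \<open>'m Rm1\<close> is $x_0$.\<close>

type_synonym 'm Rm = "real ^ 'm"
type_synonym 'm Rm1 = "real \<times> (real ^ 'm)"

definition dirac_left ::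
    "('m Rm \<Rightarrow> 'm clifford) \<Rightarrow> 'm Rm \<Rightarrow> 'm::{finite,linorder} clifford" where
  "dirac_left f x = (\<Sum>j\<in>UNIV. gen j \<odot> partial (axis j 1) f x)"

definition dirac_right ::
    "('m Rm \<Rightarrow> 'm clifford) \<Rightarrow> 'm Rm \<Rightarrow> 'm::{finite,linorder} clifford" where
  "dirac_right f x = (\<Sum>j\<in>UNIV. partial (axis j 1) f x \<odot> gen j)"

definition dirac_pow ::
    "nat \<Rightarrow> nat \<Rightarrow> ('m Rm \<Rightarrow> 'm clifford) \<Rightarrow> 'm Rm \<Rightarrow> 'm::{finite,linorder} clifford" where
  "dirac_pow p q f = (dirac_right ^^ q) ((dirac_left ^^ p) f)"

definition cr_left ::
    "('m Rm1 \<Rightarrow> 'm clifford) \<Rightarrow> 'm Rm1 \<Rightarrow> 'm::{finite,linorder} clifford"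
  where
  "cr_left f x = partial (1, 0) f x + (\<Sum>j\<in>UNIV. gen j \<odot> partial (0, axis j 1) f x)"

definition cr_right ::
    "('m Rm1 \<Rightarrow> 'm clifford) \<Rightarrow> 'm Rm1 \<Rightarrow> 'm::{finite,linorder} clifford"
  where
  "cr_right f x = partial (1, 0) f x + (\<Sum>j\<in>UNIV. partial (0, axis j 1) f x \<odot> gen j)"

definition inframonogenic_on ::
    "('m Rm1 \<Rightarrow> 'm::{finite,linorder} clifford) \<Rightarrow> 'm Rm1 set \<Rightarrow> bool"
  where
  "inframonogenic_on f \<Omega> \<longleftrightarrow>
     open \<Omega> \<and> clifford_Ck_on 2 f \<Omega> \<and> (\<forall>x\<in>\<Omega>. cr_right (cr_left f) x = 0)"

definition x0_normal_nbhd ::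
    "'m::finite Rm set \<Rightarrow> 'm Rm1 set \<Rightarrow> bool" where
  "x0_normal_nbhd \<Omega> \<Omega>' \<longleftrightarrow> open \<Omega>' \<and> {0} \<times> \<Omega> \<subseteq> \<Omega>' \<and>
     (\<forall>x\<in>\<Omega>'. connected (range (\<lambda>t. x + (t, 0)) \<inter> \<Omega>') \<and>
        (\<exists>!y. y \<in> (range (\<lambda>t. x + (t, 0)) \<inter> \<Omega>') \<inter> ({0} \<times> \<Omega>)))"

definition CK_term ::
    "('m Rm \<Rightarrow> 'm clifford) \<Rightarrow> ('m Rm \<Rightarrow> 'm clifford) \<Rightarrow> 'm Rm1 \<Rightarrow> nat
      \<Rightarrow> 'm::{finite,linorder} clifford" where
  "CK_term A0 A1 x n = ((- fst x) ^ n / fact n) *\<^sub>R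
     ((\<Sum>j=0..n-2. dirac_pow (n - j - 1) (j + 1) A0 (snd x)) +
      (\<Sum>j=0..n-1. dirac_pow (n - j - 1) j A1 (snd x)))"

text \<open>The series starts at $n = 2$, hence the shift.\<close>

definition CK ::
    "('m Rm \<Rightarrow> 'm clifford) \<Rightarrow> ('m Rm \<Rightarrow> 'm clifford) \<Rightarrow> 'm Rm1
      \<Rightarrow> 'm::{finite,linorder} clifford" where
  "CK A0 A1 x = A0 (snd x) + fst x *\<^sub>R A1 (snd x) - (\<Sum>n. CK_term A0 A1 x (n + 2))"

end

theory Submission
  imports Defs
begin

text \<open>
  Write $L$ and $R$ for the Dirac operator in $\underline x$ acting from the left and from the right.
  By associativity of the Clifford product they commute, so for $f = \sum_n x_0^n g_n / n!$ the
  equation $\partial_x f \partial_x = 0$ reads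
  $$g_{n+2} + (L + R)\, g_{n+1} + L R\, g_n = 0.$$
  This linear recursion has characteristic roots $-L$ and $-R$.  With $g_0 = A_0$, $g_1 = A_1$ its
  solution is $g_n = (-1)^{n+1} (L R\, h_{n-2} A_0 + h_{n-1} A_1)$ for $n \ge 1$, where
  $h_d = \sum_{i + j = d} L^i R^j$ is the complete homogeneous polynomial of degree $d$ (and
  $h_{-1} = 0$), so $f$ is the series $\mathsf{CK}[A_0, A_1]$.  Formally the theorem is
  the lemma \<open>CK_coeffs_rec\<close>; what remains is convergence.

  Convergence is a Cauchy--Kovalevskaya estimate, and it is carried out on coefficients.  Near a
  point $a$ an analytic function is given by a family of Clifford-valued coefficients $c_\alpha$,
  and its size is measured by $\sum_\alpha |c_\alpha| \rho^{|\alpha|}$.  A derivative costs a factor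
  $1/(\rho - \sigma)$ when the radius shrinks from $\rho$ to $\sigma$ (\<open>majorized_coeff_deriv\<close>).
  Distributing a total loss of radius $\rho/2$ evenly over $n$ derivatives gives a factor
  $(C n)^n$, which is at most $n!\, Q^n$ (\<open>coeff_dirac_pow_majorized\<close>).  The factor
  $n!$ cancels against the one in $x_0^n / n!$, so the families $g_n$ assemble to a convergent power
  series in the $m + 1$ variables $(x_0, \underline x - a)$, with a radius $\delta_a > 0$ that depends
  on $a$.  Convergent power series may be differentiated termwise
  (\<open>power_series_has_vector_derivative\<close>), hence they are smooth, and the differential equation
  holds because it holds for the coefficients.

  Finally, the union of the boxes
  $\{|x_0| < \delta_a,\ |x_i - a_i| < \delta_a \mbox{ for all } i\}$ over $a \in \underline\Omega$ is
  $x_0$-normal: along a line parallel to the $x_0$-axis it cuts out a union of intervals that are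
  symmetric about $0$.
\<close>

section \<open>Power series in finitely many variables\<close>

definition monomial :: "('k::finite \<Rightarrow> real) \<Rightarrow> ('k \<Rightarrow> nat) \<Rightarrow> real" where
  "monomial X \<alpha> = (\<Prod>k\<in>UNIV. X k ^ \<alpha> k)"

definition power_series ::
    "(('k::finite \<Rightarrow> nat) \<Rightarrow> 'b::banach) \<Rightarrow> ('k \<Rightarrow> real) \<Rightarrow> 'b" where
  "power_series c X = (\<Sum>\<^sub>\<infinity>\<alpha>. monomial X \<alpha> *\<^sub>R c \<alpha>)"

text \<open>
  This says $\sum_\alpha |c_\alpha| \rho^{|\alpha|} \le M$.  Bounding the finite partial sums
  instead of an infinite sum makes every estimate below one about finite sums, and summability
  follows from the bound.
\<close>
definition majorized ::
    "real \<Rightarrow> (('k::finite \<Rightarrow> nat) \<Rightarrow> 'b::real_normed_vector) \<Rightarrow> real \<Rightarrow> bool" where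
  "majorized \<rho> c M \<longleftrightarrow> (\<forall>F. finite F \<longrightarrow> (\<Sum>\<alpha>\<in>F. norm (c \<alpha>) * \<rho> ^ sum \<alpha> UNIV) \<le> M)"

text \<open>
  Convergence for all radii strictly below $\rho$, unlike convergence at $\rho$ itself, is
  inherited by derivatives.
\<close>
definition convergent_below ::
    "real \<Rightarrow> (('k::finite \<Rightarrow> nat) \<Rightarrow> 'b::real_normed_vector) \<Rightarrow> bool" where
  "convergent_below \<rho> c \<longleftrightarrow> (\<forall>\<sigma>. 0 < \<sigma> \<and> \<sigma> < \<rho> \<longrightarrow> (\<exists>M. majorized \<sigma> c M))"

text \<open>
  The coefficients of the partial derivative in the \<open>k\<close>-th variable of \<open>power_series c\<close>.
\<close>
definition coeff_deriv ::
    "'k \<Rightarrow> (('k::finite \<Rightarrow> nat) \<Rightarrow> 'b::real_normed_vector) \<Rightarrow> ('k \<Rightarrow> nat) \<Rightarrow> 'b" where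
  "coeff_deriv k c \<alpha> = real (Suc (\<alpha> k)) *\<^sub>R c (\<alpha>(k := Suc (\<alpha> k)))"

lemma monomial_split: "monomial X \<alpha> = X k ^ \<alpha> k * (\<Prod>i\<in>UNIV - {k}. X i ^ \<alpha> i)"
  by (simp add: monomial_def prod.remove[of UNIV k])

lemma sum_split: "sum \<alpha> (UNIV :: 'k::finite set) = \<alpha> k + sum (\<alpha> :: _ \<Rightarrow> nat) (UNIV - {k})"
  by (simp add: sum.remove[of UNIV k])

lemma sum_fun_upd_Suc: "sum (\<alpha>(k := Suc (\<alpha> k))) (UNIV :: 'k::finite set) = Suc (sum \<alpha> UNIV)"
  by (simp add: sum_split[of _ k])

lemma abs_prod_power_le:
  fixes X :: "'k \<Rightarrow> real"
  assumes "\<And>k. k \<in> A \<Longrightarrow> \<bar>X k\<bar> \<le> \<rho>"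
  shows "\<bar>\<Prod>k\<in>A. X k ^ \<alpha> k\<bar> \<le> \<rho> ^ sum \<alpha> A"
proof -
  have "\<bar>\<Prod>k\<in>A. X k ^ \<alpha> k\<bar> = (\<Prod>k\<in>A. \<bar>X k\<bar> ^ \<alpha> k)"
    by (simp add: abs_prod power_abs)
  also have "\<dots> \<le> (\<Prod>k\<in>A. \<rho> ^ \<alpha> k)"
    using assms by (intro prod_mono) (auto intro: power_mono)
  finally show ?thesis
    by (simp add: power_sum)
qed

lemma norm_monomial_scaleR_le:
  assumes "\<And>k. \<bar>X k\<bar> \<le> \<rho>"
  shows "norm (monomial X \<alpha> *\<^sub>R c \<alpha>) \<le> norm (c \<alpha>) * \<rho> ^ sum \<alpha> UNIV"
  using mult_right_mono[OF abs_prod_power_le[of UNIV X \<rho> \<alpha>, OF assms] norm_ge_zero[of "c \<alpha>"]]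
  by (simp add: monomial_def mult.commute)

section \<open>Majorants of coefficient families\<close>

lemma majorizedI:
  "(\<And>F. finite F \<Longrightarrow> (\<Sum>\<alpha>\<in>F. norm (c \<alpha>) * \<rho> ^ sum \<alpha> UNIV) \<le> M) \<Longrightarrow> majorized \<rho> c M"
  by (simp add: majorized_def)

lemma majorizedD:
  "majorized \<rho> c M \<Longrightarrow> finite F \<Longrightarrow> (\<Sum>\<alpha>\<in>F. norm (c \<alpha>) * \<rho> ^ sum \<alpha> UNIV) \<le> M"
  by (simp add: majorized_def)

lemma majorized_nonneg: "majorized \<rho> c M \<Longrightarrow> 0 \<le> M"
  using majorizedD[of \<rho> c M "{}"] by simp

lemma majorized_summable:
  assumes "majorized \<rho> c M" "0 \<le> \<rho>"
  shows "(\<lambda>\<alpha>. norm (c \<alpha>) * \<rho> ^ sum \<alpha> UNIV) summable_on UNIV"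
  using assms by (intro nonneg_bdd_above_summable_on) (auto simp: majorized_def intro!: bdd_aboveI2)

lemma majorized_mono:
  assumes "majorized \<rho> c M" "\<sigma> \<le> \<rho>" "0 \<le> \<sigma>" "M \<le> N"
  shows "majorized \<sigma> c N"
proof (rule majorizedI)
  fix F :: "('a \<Rightarrow> nat) set"
  assume "finite F"
  have "(\<Sum>\<alpha>\<in>F. norm (c \<alpha>) * \<sigma> ^ sum \<alpha> UNIV) \<le> (\<Sum>\<alpha>\<in>F. norm (c \<alpha>) * \<rho> ^ sum \<alpha> UNIV)"
    using assms by (intro sum_mono mult_left_mono power_mono) auto
  also have "\<dots> \<le> M"
    by (rule majorizedD) fact+
  finally show "(\<Sum>\<alpha>\<in>F. norm (c \<alpha>) * \<sigma> ^ sum \<alpha> UNIV) \<le> N"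
    using assms by simp
qed

lemma majorized_zero: "majorized \<rho> (\<lambda>\<alpha>. 0) 0"
  by (simp add: majorized_def)

lemma majorized_add:
  assumes "majorized \<rho> c M" "majorized \<rho> d N" "0 \<le> \<rho>"
  shows "majorized \<rho> (\<lambda>\<alpha>. c \<alpha> + d \<alpha>) (M + N)"
proof (rule majorizedI)
  fix F :: "('a \<Rightarrow> nat) set"
  assume F: "finite F"
  have "(\<Sum>\<alpha>\<in>F. norm (c \<alpha> + d \<alpha>) * \<rho> ^ sum \<alpha> UNIV) \<le>
      (\<Sum>\<alpha>\<in>F. norm (c \<alpha>) * \<rho> ^ sum \<alpha> UNIV + norm (d \<alpha>) * \<rho> ^ sum \<alpha> UNIV)"
    unfolding distrib_right[symmetric] using assms
    by (intro sum_mono mult_right_mono norm_triangle_ineq) auto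
  also have "\<dots> \<le> M + N"
    unfolding sum.distrib using F assms by (intro add_mono majorizedD) auto
  finally show "(\<Sum>\<alpha>\<in>F. norm (c \<alpha> + d \<alpha>) * \<rho> ^ sum \<alpha> UNIV) \<le> M + N" .
qed

lemma majorized_sum:
  assumes "\<And>i. i \<in> I \<Longrightarrow> majorized \<rho> (c i) (M i)" "0 \<le> \<rho>"
  shows "majorized \<rho> (\<lambda>\<alpha>. \<Sum>i\<in>I. c i \<alpha>) (\<Sum>i\<in>I. M i)"
  using assms by (induction I rule: infinite_finite_induct) (auto intro: majorized_zero majorized_add)

lemma majorized_linear:
  assumes "majorized \<rho> c M" "0 \<le> \<rho>" "\<And>x. norm (h x) \<le> B * norm x" "0 \<le> B"
  shows "majorized \<rho> (\<lambda>\<alpha>. h (c \<alpha>)) (B * M)"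
proof (rule majorizedI)
  fix F :: "('a \<Rightarrow> nat) set"
  assume F: "finite F"
  have "(\<Sum>\<alpha>\<in>F. norm (h (c \<alpha>)) * \<rho> ^ sum \<alpha> UNIV) \<le> (\<Sum>\<alpha>\<in>F. (B * norm (c \<alpha>)) * \<rho> ^ sum \<alpha> UNIV)"
    using assms by (intro sum_mono mult_right_mono) auto
  also have "\<dots> = B * (\<Sum>\<alpha>\<in>F. norm (c \<alpha>) * \<rho> ^ sum \<alpha> UNIV)"
    by (simp add: sum_distrib_left mult.assoc)
  also have "\<dots> \<le> B * M"
    using F assms by (intro mult_left_mono majorizedD) auto
  finally show "(\<Sum>\<alpha>\<in>F. norm (h (c \<alpha>)) * \<rho> ^ sum \<alpha> UNIV) \<le> B * M" .
qed

text \<open>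
  The one-variable Cauchy estimate for monomials: in
  $\rho^{n+1} - \sigma^{n+1} = (\rho - \sigma) \sum_{i \le n} \sigma^{n-i} \rho^i$ each of the
  $n + 1$ summands is at least $\sigma^n$.
\<close>
lemma Suc_mult_power_le:
  fixes \<sigma> \<rho> :: real
  assumes "0 \<le> \<sigma>" "\<sigma> < \<rho>"
  shows "real (Suc n) * \<sigma> ^ n \<le> \<rho> ^ Suc n / (\<rho> - \<sigma>)"
proof -
  have "(\<rho> - \<sigma>) * (real (Suc n) * \<sigma> ^ n) \<le> (\<rho> - \<sigma>) * (\<Sum>i<Suc n. \<sigma> ^ (Suc n - Suc i) * \<rho> ^ i)"
  proof (intro mult_left_mono)
    have "real (Suc n) * \<sigma> ^ n = (\<Sum>i<Suc n. \<sigma> ^ (n - i) * \<sigma> ^ i)"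
      by (simp add: power_add[symmetric])
    also have "\<dots> \<le> (\<Sum>i<Suc n. \<sigma> ^ (Suc n - Suc i) * \<rho> ^ i)"
      using assms by (intro sum_mono mult_mono power_mono) auto
    finally show "real (Suc n) * \<sigma> ^ n \<le> (\<Sum>i<Suc n. \<sigma> ^ (Suc n - Suc i) * \<rho> ^ i)" .
  qed (use assms in auto)
  also have "\<dots> = \<rho> ^ Suc n - \<sigma> ^ Suc n"
    by (rule power_diff_sumr2[symmetric])
  also have "\<dots> \<le> \<rho> ^ Suc n"
    using assms by simp
  finally show ?thesis
    using assms by (simp add: field_simps)
qed

lemma inj_fun_upd_Suc: "inj (\<lambda>\<alpha>. \<alpha>(k := Suc (\<alpha> k)))"
proof (rule injI)
  fix \<alpha> \<beta> :: "'a \<Rightarrow> nat"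
  assume *: "\<alpha>(k := Suc (\<alpha> k)) = \<beta>(k := Suc (\<beta> k))"
  have "\<alpha> i = \<beta> i" for i
    using fun_cong[OF *, of i] by (cases "i = k") auto
  then show "\<alpha> = \<beta>" ..
qed

text \<open>
  The Cauchy estimate in several variables.  By \<open>Suc_mult_power_le\<close>, the summand for
  $\alpha$ is at most $1/(\rho - \sigma)$ times the summand of \<open>c\<close> for the index obtained by raising
  $\alpha_k$ by one, and distinct $\alpha$ give distinct such indices.
\<close>
lemma majorized_coeff_deriv:
  assumes "majorized \<rho> c M" "0 \<le> \<sigma>" "\<sigma> < \<rho>"
  shows "majorized \<sigma> (coeff_deriv k c) (M / (\<rho> - \<sigma>))"
proof (rule majorizedI)
  fix F :: "('a \<Rightarrow> nat) set"
  assume F: "finite F"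
  let ?u = "\<lambda>\<alpha>. \<alpha>(k := Suc (\<alpha> k))"
  have "norm (coeff_deriv k c \<alpha>) * \<sigma> ^ sum \<alpha> UNIV \<le>
      norm (c (?u \<alpha>)) * \<rho> ^ sum (?u \<alpha>) UNIV / (\<rho> - \<sigma>)" for \<alpha>
  proof -
    have "real (Suc (\<alpha> k)) * \<sigma> ^ sum \<alpha> UNIV \<le> real (Suc (sum \<alpha> UNIV)) * \<sigma> ^ sum \<alpha> UNIV"
      using assms by (intro mult_right_mono) (auto simp: sum_split[of \<alpha> k] simp del: of_nat_sum)
    also have "\<dots> \<le> \<rho> ^ Suc (sum \<alpha> UNIV) / (\<rho> - \<sigma>)"
      using assms(2,3) by (rule Suc_mult_power_le)
    finally have "norm (c (?u \<alpha>)) * (real (Suc (\<alpha> k)) * \<sigma> ^ sum \<alpha> UNIV) \<le>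
        norm (c (?u \<alpha>)) * (\<rho> ^ Suc (sum \<alpha> UNIV) / (\<rho> - \<sigma>))"
      by (intro mult_left_mono) auto
    then show ?thesis
      unfolding sum_fun_upd_Suc coeff_deriv_def by (simp add: mult_ac del: of_nat_Suc)
  qed
  then have "(\<Sum>\<alpha>\<in>F. norm (coeff_deriv k c \<alpha>) * \<sigma> ^ sum \<alpha> UNIV) \<le>
      (\<Sum>\<alpha>\<in>F. norm (c (?u \<alpha>)) * \<rho> ^ sum (?u \<alpha>) UNIV) / (\<rho> - \<sigma>)"
    unfolding sum_divide_distrib by (intro sum_mono)
  also have "(\<Sum>\<alpha>\<in>F. norm (c (?u \<alpha>)) * \<rho> ^ sum (?u \<alpha>) UNIV) =
      (\<Sum>\<alpha>\<in>?u ` F. norm (c \<alpha>) * \<rho> ^ sum \<alpha> UNIV)"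
    by (subst sum.reindex[OF inj_on_subset[OF inj_fun_upd_Suc]]) auto
  also have "\<dots> / (\<rho> - \<sigma>) \<le> M / (\<rho> - \<sigma>)"
    using assms F by (intro divide_right_mono majorizedD) auto
  finally show "(\<Sum>\<alpha>\<in>F. norm (coeff_deriv k c \<alpha>) * \<sigma> ^ sum \<alpha> UNIV) \<le> M / (\<rho> - \<sigma>)" .
qed

lemma majorized_imp_convergent_below: "majorized \<rho> c M \<Longrightarrow> convergent_below \<rho> c"
  unfolding convergent_below_def by (metis less_imp_le majorized_mono order_refl)

lemma convergent_below_coeff_deriv:
  assumes "convergent_below \<rho> c"
  shows "convergent_below \<rho> (coeff_deriv k c)"
  unfolding convergent_below_def
proof safe
  fix \<sigma> assume \<sigma>: "0 < \<sigma>" "\<sigma> < \<rho>"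
  then obtain \<tau> where \<tau>: "\<sigma> < \<tau>" "\<tau> < \<rho>"
    using dense by blast
  then obtain M where "majorized \<tau> c M"
    using assms \<sigma> unfolding convergent_below_def by fastforce
  then show "\<exists>M. majorized \<sigma> (coeff_deriv k c) M"
    using majorized_coeff_deriv[of \<tau> c M \<sigma> k] \<tau> \<sigma> by auto
qed

lemma convergent_below_add:
  assumes "convergent_below \<rho> c" "convergent_below \<rho> d"
  shows "convergent_below \<rho> (\<lambda>\<alpha>. c \<alpha> + d \<alpha>)"
  unfolding convergent_below_def
proof safe
  fix \<sigma> assume \<sigma>: "0 < \<sigma>" "\<sigma> < \<rho>"
  then obtain M N where "majorized \<sigma> c M" "majorized \<sigma> d N"
    using assms unfolding convergent_below_def by blast
  then have "majorized \<sigma> (\<lambda>\<alpha>. c \<alpha> + d \<alpha>) (M + N)"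
    using \<sigma> by (intro majorized_add) auto
  then show "\<exists>M. majorized \<sigma> (\<lambda>\<alpha>. c \<alpha> + d \<alpha>) M" ..
qed

lemma convergent_below_sum:
  assumes "\<And>i. i \<in> I \<Longrightarrow> convergent_below \<rho> (c i)"
  shows "convergent_below \<rho> (\<lambda>\<alpha>. \<Sum>i\<in>I. c i \<alpha>)"
  using assms
proof (induction I rule: infinite_finite_induct)
  case (insert i I)
  then show ?case by (simp add: convergent_below_add)
qed (auto simp: convergent_below_def intro: majorized_zero)

lemma convergent_below_linear:
  assumes "convergent_below \<rho> c" "bounded_linear h"
  shows "convergent_below \<rho> (\<lambda>\<alpha>. h (c \<alpha>))"
proof -
  obtain B where B: "0 \<le> B" "\<And>x. norm (h x) \<le> norm x * B"
    using bounded_linear.nonneg_bounded[OF assms(2)] by blast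
  show ?thesis
    unfolding convergent_below_def
  proof safe
    fix \<sigma> assume \<sigma>: "0 < \<sigma>" "\<sigma> < \<rho>"
    then obtain M where "majorized \<sigma> c M"
      using assms unfolding convergent_below_def by blast
    then have "majorized \<sigma> (\<lambda>\<alpha>. h (c \<alpha>)) (B * M)"
      using \<sigma> B by (intro majorized_linear) (auto simp: mult.commute)
    then show "\<exists>M. majorized \<sigma> (\<lambda>\<alpha>. h (c \<alpha>)) M" ..
  qed
qed

text \<open>
  As there are finitely many variables, the strict bounds on the coordinates leave room for two
  further radii: the coordinates stay below $\sigma$ in a whole neighbourhood, and the gap between
  $\sigma$ and $\tau$ pays for a derivative.
\<close>
lemma convergent_below_obtain:
  fixes X :: "'k::finite \<Rightarrow> real"
  assumes "convergent_below \<rho> c" "\<And>k. \<bar>X k\<bar> < \<rho>"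
  obtains \<sigma> \<tau> M where "0 < \<sigma>" "\<sigma> < \<tau>" "\<tau> < \<rho>" "\<And>k. \<bar>X k\<bar> < \<sigma>" "majorized \<tau> c M"
proof -
  define m where "m = Max (range (\<lambda>k. \<bar>X k\<bar>))"
  have m: "\<bar>X k\<bar> \<le> m" for k
    unfolding m_def by (intro Max_ge) auto
  have "m < \<rho>"
    unfolding m_def using assms(2) by (subst Max_less_iff) auto
  then obtain \<sigma> where \<sigma>: "m < \<sigma>" "\<sigma> < \<rho>"
    using dense by blast
  then obtain \<tau> where \<tau>: "\<sigma> < \<tau>" "\<tau> < \<rho>"
    using dense by blast
  have "\<bar>X k\<bar> < \<sigma>" for k
    using m[of k] \<sigma> by simp
  moreover have "0 < \<sigma>"
    using abs_ge_zero[of "X undefined"] m[of undefined] \<sigma> by linarith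
  moreover obtain M where "majorized \<tau> c M"
    using assms(1) \<open>0 < \<sigma>\<close> \<tau> unfolding convergent_below_def by fastforce
  ultimately show ?thesis
    using that \<tau> by blast
qed

lemma power_series_abs_summable:
  fixes c :: "('k::finite \<Rightarrow> nat) \<Rightarrow> 'b::banach"
  assumes "convergent_below \<rho> c" "\<And>k. \<bar>X k\<bar> < \<rho>"
  shows "(\<lambda>\<alpha>. monomial X \<alpha> *\<^sub>R c \<alpha>) abs_summable_on UNIV"
proof -
  obtain \<sigma> \<tau> M where *: "0 < \<sigma>" "\<sigma> < \<tau>" "\<tau> < \<rho>" "\<And>k. \<bar>X k\<bar> < \<sigma>" "majorized \<tau> c M"
    using convergent_below_obtain[of \<rho> c X] assms by metis
  show ?thesis
  proof (rule Infinite_Sum.abs_summable_on_comparison_test')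
    show "(\<lambda>\<alpha>. norm (c \<alpha>) * \<tau> ^ sum \<alpha> UNIV) summable_on UNIV"
      using * by (intro majorized_summable) auto
    show "norm (monomial X \<alpha> *\<^sub>R c \<alpha>) \<le> norm (c \<alpha>) * \<tau> ^ sum \<alpha> UNIV" for \<alpha>
      using * by (intro norm_monomial_scaleR_le) (meson less_imp_le less_trans)
  qed
qed

lemma power_series_has_sum:
  assumes "convergent_below \<rho> c" "\<And>k. \<bar>X k\<bar> < \<rho>"
  shows "((\<lambda>\<alpha>. monomial X \<alpha> *\<^sub>R c \<alpha>) has_sum power_series c X) UNIV"
  unfolding power_series_def
  using abs_summable_summable[OF power_series_abs_summable[OF assms]] by (rule has_sum_infsum)

lemma power_series_eqI:
  "((\<lambda>\<alpha>. monomial X \<alpha> *\<^sub>R c \<alpha>) has_sum s) UNIV \<Longrightarrow> power_series c X = s"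
  unfolding power_series_def by (rule infsumI)

lemma power_series_zero: "power_series (\<lambda>\<alpha>. 0) X = 0"
  by (simp add: power_series_def)

lemma power_series_add:
  assumes "convergent_below \<rho> c" "convergent_below \<rho> d" "\<And>k. \<bar>X k\<bar> < \<rho>"
  shows "power_series (\<lambda>\<alpha>. c \<alpha> + d \<alpha>) X = power_series c X + power_series d X"
  using has_sum_add[OF power_series_has_sum power_series_has_sum, OF assms(1,3,2,3)]
  by (intro power_series_eqI) (simp add: scaleR_add_right)

lemma power_series_linear:
  assumes "convergent_below \<rho> c" "bounded_linear h" "\<And>k. \<bar>X k\<bar> < \<rho>"
  shows "power_series (\<lambda>\<alpha>. h (c \<alpha>)) X = h (power_series c X)"
  using has_sum_bounded_linear[OF assms(2) power_series_has_sum[OF assms(1,3)]]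
  by (intro power_series_eqI) (simp add: linear_cmul[OF bounded_linear.linear[OF assms(2)]])

lemma power_series_sum:
  assumes "\<And>i. i \<in> I \<Longrightarrow> convergent_below \<rho> (c i)" "\<And>k. \<bar>X k\<bar> < \<rho>"
  shows "power_series (\<lambda>\<alpha>. \<Sum>i\<in>I. c i \<alpha>) X = (\<Sum>i\<in>I. power_series (c i) X)"
  using assms(1)
proof (induction I rule: infinite_finite_induct)
  case (insert i I)
  then show ?case
    by (simp add: power_series_add[OF _ convergent_below_sum assms(2)])
qed (auto simp: power_series_zero)

lemma power_series_at_0:
  fixes c :: "('k::finite \<Rightarrow> nat) \<Rightarrow> 'b::banach"
  shows "power_series c (\<lambda>k. 0) = c (\<lambda>k. 0)"
proof -
  have "monomial (\<lambda>k. 0) \<alpha> *\<^sub>R c \<alpha> = 0" if "\<alpha> \<noteq> (\<lambda>k. 0)" for \<alpha> :: "'k \<Rightarrow> nat"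
    using that by (auto simp: monomial_def fun_eq_iff)
  then have "((\<lambda>\<alpha>. monomial (\<lambda>k. 0) \<alpha> *\<^sub>R c \<alpha>) has_sum c (\<lambda>k. 0)) UNIV"
    by (intro has_sum_finite_neutralI[of "{\<lambda>k. 0}"]) (auto simp: monomial_def)
  then show ?thesis
    by (rule power_series_eqI)
qed

section \<open>Continuity and partial derivatives of power series\<close>

lemma continuous_on_infsum:
  fixes f :: "'i \<Rightarrow> 'a::topological_space \<Rightarrow> 'b::banach"
  assumes "\<And>i. continuous_on S (f i)" "\<And>i x. x \<in> S \<Longrightarrow> norm (f i x) \<le> M i" "M summable_on UNIV"
  shows "continuous_on S (\<lambda>x. \<Sum>\<^sub>\<infinity>i. f i x)"
proof (rule uniform_limit_theorem)
  show "uniform_limit S (\<lambda>F x. \<Sum>i\<in>F. f i x) (\<lambda>x. \<Sum>\<^sub>\<infinity>i. f i x) (finite_subsets_at_top UNIV)"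
    using assms by (intro Weierstrass_m_test_general) auto
  show "\<forall>\<^sub>F F in finite_subsets_at_top UNIV. continuous_on S (\<lambda>x. \<Sum>i\<in>F. f i x)"
    using assms by (intro always_eventually allI continuous_on_sum) auto
qed simp

lemma power_series_isCont:
  fixes X :: "'a::t2_space \<Rightarrow> 'k::finite \<Rightarrow> real"
  assumes "convergent_below \<rho> c" "\<And>k. \<bar>X x k\<bar> < \<rho>" "\<And>k. continuous_on UNIV (\<lambda>y. X y k)"
  shows "isCont (\<lambda>y. power_series c (X y)) x"
proof -
  obtain \<sigma> \<tau> M where *: "0 < \<sigma>" "\<sigma> < \<tau>" "\<tau> < \<rho>" "\<And>k. \<bar>X x k\<bar> < \<sigma>" "majorized \<tau> c M"
    using convergent_below_obtain[of \<rho> c "X x"] assms by metis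
  define S where "S = {y. \<forall>k. \<bar>X y k\<bar> < \<sigma>}"
  have "open S"
    unfolding S_def Collect_all_eq using assms(3)
    by (intro open_INT ballI open_Collect_less continuous_intros) auto
  moreover have "continuous_on S (\<lambda>y. power_series c (X y))"
    unfolding power_series_def
  proof (rule continuous_on_infsum)
    show "continuous_on S (\<lambda>y. monomial (X y) \<alpha> *\<^sub>R c \<alpha>)" for \<alpha>
      unfolding monomial_def using assms(3)
      by (intro continuous_intros) (auto intro: continuous_on_subset)
    show "norm (monomial (X y) \<alpha> *\<^sub>R c \<alpha>) \<le> norm (c \<alpha>) * \<tau> ^ sum \<alpha> UNIV" if "y \<in> S" for y \<alpha>
      using that *(2) unfolding S_def
      by (intro norm_monomial_scaleR_le) (auto intro: less_imp_le less_trans)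
    show "(\<lambda>\<alpha>. norm (c \<alpha>) * \<tau> ^ sum \<alpha> UNIV) summable_on UNIV"
      using * by (intro majorized_summable) auto
  qed
  moreover have "x \<in> S"
    using * by (simp add: S_def)
  ultimately show ?thesis
    by (simp add: continuous_on_eq_continuous_at)
qed

lemma abs_divided_difference_power_le:
  fixes u v \<sigma> :: real
  assumes "\<bar>u\<bar> \<le> \<sigma>" "\<bar>v\<bar> \<le> \<sigma>"
  shows "\<bar>\<Sum>i<n. u ^ (n - Suc i) * v ^ i\<bar> \<le> real n * \<sigma> ^ (n - 1)"
proof -
  have "\<bar>u ^ (n - Suc i) * v ^ i\<bar> \<le> \<sigma> ^ (n - 1)" if "i < n" for i
  proof -
    have "\<bar>u ^ (n - Suc i) * v ^ i\<bar> \<le> \<sigma> ^ (n - Suc i) * \<sigma> ^ i"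
      unfolding abs_mult power_abs using assms by (intro mult_mono power_mono) auto
    also have "\<dots> = \<sigma> ^ (n - 1)"
      using that by (simp add: power_add[symmetric])
    finally show ?thesis .
  qed
  then have "(\<Sum>i<n. \<bar>u ^ (n - Suc i) * v ^ i\<bar>) \<le> (\<Sum>i<n. \<sigma> ^ (n - 1))"
    by (intro sum_mono) auto
  then show ?thesis
    by (intro order_trans[OF sum_abs]) simp
qed

text \<open>
  The difference quotient of a power is the polynomial
  $\frac{(x + t)^n - x^n}{t} = \sum_{i < n} x^{n-1-i} (x + t)^i$, which makes sense at $t = 0$ too.
  Replacing the \<open>k\<close>-th power in each monomial by it gives a series that converges uniformly in
  $t$, hence is continuous at $t = 0$; its value there is the termwise derivative.
\<close>
lemma power_series_has_vector_derivative:
  fixes c :: "('k::finite \<Rightarrow> nat) \<Rightarrow> 'b::banach"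
  assumes conv: "convergent_below \<rho> c" and X: "\<And>i. \<bar>X i\<bar> < \<rho>"
  shows "((\<lambda>t. power_series c (X(k := X k + t))) has_vector_derivative
    power_series (coeff_deriv k c) X) (at 0)"
proof -
  obtain \<sigma> \<tau> M where *: "0 < \<sigma>" "\<sigma> < \<tau>" "\<tau> < \<rho>" "\<And>i. \<bar>X i\<bar> < \<sigma>" "majorized \<tau> c M"
    using convergent_below_obtain[of \<rho> c X] assms by metis
  define Q :: "('k \<Rightarrow> nat) \<Rightarrow> real \<Rightarrow> real" where "Q = (\<lambda>\<alpha> t.
    (\<Sum>i<\<alpha> k. X k ^ (\<alpha> k - Suc i) * (X k + t) ^ i) * (\<Prod>i\<in>UNIV - {k}. X i ^ \<alpha> i))"
  define S where "S = {t. \<bar>X k + t\<bar> < \<sigma>}"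
  have S: "open S" "0 \<in> S"
    using *(4) unfolding S_def by (auto intro!: open_Collect_less continuous_intros)
  have Q_diff: "monomial (X(k := X k + t)) \<alpha> - monomial X \<alpha> = t * Q \<alpha> t" for \<alpha> t
  proof -
    have "monomial (X(k := X k + t)) \<alpha> - monomial X \<alpha> =
        ((X k + t) ^ \<alpha> k - X k ^ \<alpha> k) * (\<Prod>i\<in>UNIV - {k}. X i ^ \<alpha> i)"
      unfolding monomial_split[of _ _ k] by (simp add: left_diff_distrib)
    then show ?thesis
      by (simp add: power_diff_sumr2[of "X k + t"] Q_def)
  qed
  have Q_le: "norm (Q \<alpha> t *\<^sub>R c \<alpha>) \<le> norm (c \<alpha>) * \<tau> ^ sum \<alpha> UNIV * (1 / (\<tau> - \<sigma>))"
    if "t \<in> S" for \<alpha> t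
  proof -
    have "\<bar>Q \<alpha> t\<bar> \<le> (real (\<alpha> k) * \<sigma> ^ (\<alpha> k - 1)) * \<sigma> ^ sum \<alpha> (UNIV - {k})"
      unfolding Q_def abs_mult using that * unfolding S_def
      by (intro mult_mono abs_divided_difference_power_le abs_prod_power_le)
        (auto intro: less_imp_le)
    also have "\<dots> \<le> (\<tau> ^ \<alpha> k / (\<tau> - \<sigma>)) * \<tau> ^ sum \<alpha> (UNIV - {k})"
    proof (intro mult_mono power_mono)
      show "real (\<alpha> k) * \<sigma> ^ (\<alpha> k - 1) \<le> \<tau> ^ \<alpha> k / (\<tau> - \<sigma>)"
        using Suc_mult_power_le[of \<sigma> \<tau> "\<alpha> k - 1"] * by (cases "\<alpha> k") auto
    qed (use * in auto)
    also have "\<dots> = \<tau> ^ sum \<alpha> UNIV * (1 / (\<tau> - \<sigma>))"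
      by (simp add: sum_split[of \<alpha> k] power_add)
    finally have "norm (c \<alpha>) * \<bar>Q \<alpha> t\<bar> \<le> norm (c \<alpha>) * (\<tau> ^ sum \<alpha> UNIV * (1 / (\<tau> - \<sigma>)))"
      by (intro mult_left_mono) auto
    then show ?thesis
      by (simp add: mult_ac)
  qed
  have "(\<lambda>\<alpha>. norm (c \<alpha>) * \<tau> ^ sum \<alpha> UNIV) summable_on UNIV"
    using *(1,2) by (intro majorized_summable[OF *(5)]) linarith
  then have major: "(\<lambda>\<alpha>. norm (c \<alpha>) * \<tau> ^ sum \<alpha> UNIV * (1 / (\<tau> - \<sigma>))) summable_on UNIV"
    by (rule summable_on_cmult_left)
  define q where "q t = (\<Sum>\<^sub>\<infinity>\<alpha>. Q \<alpha> t *\<^sub>R c \<alpha>)" for t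
  have q_sum: "((\<lambda>\<alpha>. Q \<alpha> t *\<^sub>R c \<alpha>) has_sum q t) UNIV" if "t \<in> S" for t
    unfolding q_def using Infinite_Sum.abs_summable_on_comparison_test'[OF major Q_le[OF that]]
    by (rule has_sum_infsum[OF abs_summable_summable])
  have "continuous_on S q"
    unfolding q_def
    by (rule continuous_on_infsum[OF _ Q_le major]) (auto simp: Q_def intro!: continuous_intros)
  then have "(q \<longlongrightarrow> q 0) (at 0)"
    using S by (auto simp: continuous_on_eq_continuous_at isCont_def)
  moreover have "q 0 = power_series (coeff_deriv k c) X"
  proof -
    \<comment> \<open>At $t = 0$ only the indices with $\alpha_k > 0$ contribute; shifting them down by one
      turns the sum into the series of \<open>coeff_deriv k c\<close>.\<close>
    let ?u = "\<lambda>\<alpha>. \<alpha>(k := Suc (\<alpha> k))"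
    have Q0: "Q \<alpha> 0 = real (\<alpha> k) * X k ^ (\<alpha> k - 1) * (\<Prod>i\<in>UNIV - {k}. X i ^ \<alpha> i)" for \<alpha>
      by (simp add: Q_def power_add[symmetric])
    have "((\<lambda>\<alpha>. Q \<alpha> 0 *\<^sub>R c \<alpha>) has_sum q 0) (range ?u)"
    proof (subst has_sum_cong_neutral[where T = UNIV])
      fix \<alpha> :: "'k \<Rightarrow> nat"
      assume "\<alpha> \<in> UNIV - range ?u"
      have "\<alpha> k = 0"
      proof (rule ccontr)
        assume "\<alpha> k \<noteq> 0"
        then have "\<alpha> = ?u (\<alpha>(k := \<alpha> k - 1))"
          by auto
        then have "\<alpha> \<in> range ?u"
          by (rule range_eqI[where f = ?u and x = "\<alpha>(k := \<alpha> k - 1)"])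
        with \<open>\<alpha> \<in> UNIV - range ?u\<close> show False
          unfolding Diff_iff by (elim conjE notE)
      qed
      then show "Q \<alpha> 0 *\<^sub>R c \<alpha> = 0"
        by (simp add: Q0)
    qed (use q_sum S in auto)
    then have "((\<lambda>\<alpha>. Q (?u \<alpha>) 0 *\<^sub>R c (?u \<alpha>)) has_sum q 0) UNIV"
      by (subst (asm) has_sum_reindex[OF inj_fun_upd_Suc]) (simp add: o_def)
    moreover have "Q (?u \<alpha>) 0 *\<^sub>R c (?u \<alpha>) = monomial X \<alpha> *\<^sub>R coeff_deriv k c \<alpha>" for \<alpha>
      by (simp add: Q0 coeff_deriv_def monomial_split[of _ _ k] mult_ac)
    ultimately show ?thesis
      by (simp add: power_series_eqI)
  qed
  moreover have "\<forall>\<^sub>F t in at 0. q t = (power_series c (X(k := X k + t)) - power_series c X) /\<^sub>R t"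
  proof -
    have "q t = (power_series c (X(k := X k + t)) - power_series c X) /\<^sub>R t" if "t \<in> S" "t \<noteq> 0" for t
    proof -
      have "\<bar>(X(k := X k + t)) i\<bar> < \<rho>" for i
        using that(1) *(2,3) X[of i] by (auto simp: S_def)
      then have "((\<lambda>\<alpha>. monomial (X(k := X k + t)) \<alpha> *\<^sub>R c \<alpha>) has_sum
          power_series c (X(k := X k + t))) UNIV"
        using conv by (intro power_series_has_sum)
      moreover have "((\<lambda>\<alpha>. - (monomial X \<alpha> *\<^sub>R c \<alpha>)) has_sum - power_series c X) UNIV"
        using power_series_has_sum[OF conv X] by (simp add: has_sum_uminus)
      ultimately have "((\<lambda>\<alpha>. monomial (X(k := X k + t)) \<alpha> *\<^sub>R c \<alpha> + - (monomial X \<alpha> *\<^sub>R c \<alpha>)) has_sum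
          (power_series c (X(k := X k + t)) + - power_series c X)) UNIV"
        by (rule has_sum_add)
      then have "((\<lambda>\<alpha>. t *\<^sub>R (Q \<alpha> t *\<^sub>R c \<alpha>)) has_sum
          (power_series c (X(k := X k + t)) - power_series c X)) UNIV"
        by (simp add: scaleR_diff_left[symmetric] Q_diff)
      moreover have "((\<lambda>\<alpha>. t *\<^sub>R (Q \<alpha> t *\<^sub>R c \<alpha>)) has_sum t *\<^sub>R q t) UNIV"
        using q_sum[OF that(1)] by (rule has_sum_scaleR)
      ultimately have "power_series c (X(k := X k + t)) - power_series c X = t *\<^sub>R q t"
        by (rule has_sum_unique)
      then show ?thesis
        using that by simp
    qed
    then show ?thesis
      using S by (auto simp: eventually_at_topological)
  qed
  ultimately have lim: "((\<lambda>t. (power_series c (X(k := X k + t)) - power_series c X) /\<^sub>R t) \<longlongrightarrow>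
      power_series (coeff_deriv k c) X) (at 0)"
    by (auto intro: Lim_transform_eventually)
  show ?thesis
    unfolding has_vector_derivative_def has_derivative_at
  proof (intro conjI)
    show "bounded_linear (\<lambda>t. t *\<^sub>R power_series (coeff_deriv k c) X)"
      by (rule bounded_linear_scaleR_left)
    show "((\<lambda>t. norm (power_series c (X(k := X k + (0 + t))) - power_series c (X(k := X k + 0)) -
        t *\<^sub>R power_series (coeff_deriv k c) X) / norm t) \<longlongrightarrow> 0) (at 0)"
    proof (rule Lim_transform_eventually)
      show "((\<lambda>t. norm ((power_series c (X(k := X k + t)) - power_series c X) /\<^sub>R t -
          power_series (coeff_deriv k c) X)) \<longlongrightarrow> 0) (at 0)"
        using lim by (intro tendsto_norm_zero LIM_zero)
      have "norm (v /\<^sub>R t - w) = norm (v - t *\<^sub>R w) / norm t" if "t \<noteq> 0" for t and v w :: 'b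
      proof -
        have "v /\<^sub>R t - w = (v - t *\<^sub>R w) /\<^sub>R t"
          using that by (simp add: scaleR_diff_right)
        then show ?thesis
          by (simp add: divide_inverse)
      qed
      then show "\<forall>\<^sub>F t in at 0. norm ((power_series c (X(k := X k + t)) - power_series c X) /\<^sub>R t -
          power_series (coeff_deriv k c) X) = norm (power_series c (X(k := X k + (0 + t))) -
          power_series c (X(k := X k + 0)) - t *\<^sub>R power_series (coeff_deriv k c) X) / norm t"
        by (auto simp: eventually_at_filter)
    qed
  qed
qed

section \<open>Dirac operators on coefficient families\<close>
lemma bounded_bilinear_clifford_mult:
  "bounded_bilinear (clifford_mult :: 'm::{finite,linorder} clifford \<Rightarrow> _)"
  using bilinear_clifford_mult bilinear_conv_bounded_bilinear by blast

interpretation clifford: bounded_bilinear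
  "clifford_mult :: 'm::{finite,linorder} clifford \<Rightarrow> _"
  by (rule bounded_bilinear_clifford_mult)

lemma coeff_deriv_add: "coeff_deriv k (\<lambda>\<alpha>. c \<alpha> + d \<alpha>) = (\<lambda>\<alpha>. coeff_deriv k c \<alpha> + coeff_deriv k d \<alpha>)"
  by (simp add: coeff_deriv_def fun_eq_iff scaleR_add_right)

lemma coeff_deriv_linear:
  "linear h \<Longrightarrow> coeff_deriv k (\<lambda>\<alpha>. h (c \<alpha>)) = (\<lambda>\<alpha>. h (coeff_deriv k c \<alpha>))"
  by (simp add: coeff_deriv_def fun_eq_iff linear_cmul)

lemma coeff_deriv_sum:
  "coeff_deriv k (\<lambda>\<alpha>. \<Sum>i\<in>I. c i \<alpha>) = (\<lambda>\<alpha>. \<Sum>i\<in>I. coeff_deriv k (c i) \<alpha>)"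
  by (simp add: coeff_deriv_def fun_eq_iff scaleR_sum_right)

lemma coeff_deriv_commute: "coeff_deriv j (coeff_deriv k c) = coeff_deriv k (coeff_deriv j c)"
  by (cases "j = k") (auto simp: coeff_deriv_def fun_eq_iff fun_upd_twist mult.commute)

definition coeff_dirac_left ::
    "(('m \<Rightarrow> nat) \<Rightarrow> 'm clifford) \<Rightarrow> ('m \<Rightarrow> nat) \<Rightarrow> 'm::{finite,linorder} clifford" where
  "coeff_dirac_left c \<alpha> = (\<Sum>j\<in>UNIV. gen j \<odot> coeff_deriv j c \<alpha>)"

definition coeff_dirac_right ::
    "(('m \<Rightarrow> nat) \<Rightarrow> 'm clifford) \<Rightarrow> ('m \<Rightarrow> nat) \<Rightarrow> 'm::{finite,linorder} clifford" where
  "coeff_dirac_right c \<alpha> = (\<Sum>j\<in>UNIV. coeff_deriv j c \<alpha> \<odot> gen j)"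

lemma coeff_deriv_gen_mult:
  "coeff_deriv k (\<lambda>\<alpha>. gen j \<odot> c \<alpha>) = (\<lambda>\<alpha>. gen j \<odot> coeff_deriv k c \<alpha>)"
  "coeff_deriv k (\<lambda>\<alpha>. c \<alpha> \<odot> gen j) = (\<lambda>\<alpha>. coeff_deriv k c \<alpha> \<odot> gen j)"
  by (simp_all add: coeff_deriv_def fun_eq_iff clifford.scaleR_left clifford.scaleR_right)

text \<open>
  Partial derivatives commute with each other and with multiplication by constants, so the claim
  reduces to $e_j (c\, e_k) = (e_j\, c)\, e_k$.
\<close>
lemma coeff_dirac_commute:
  "coeff_dirac_left (coeff_dirac_right c) = coeff_dirac_right (coeff_dirac_left c)"
proof
  fix \<alpha>
  have "coeff_dirac_left (coeff_dirac_right c) \<alpha> =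
      (\<Sum>j\<in>UNIV. \<Sum>k\<in>UNIV. gen j \<odot> (coeff_deriv j (coeff_deriv k c) \<alpha> \<odot> gen k))"
    unfolding coeff_dirac_left_def coeff_dirac_right_def[abs_def]
    by (simp add: coeff_deriv_sum coeff_deriv_gen_mult clifford.sum_right)
  also have "\<dots> = (\<Sum>k\<in>UNIV. \<Sum>j\<in>UNIV. (gen j \<odot> coeff_deriv k (coeff_deriv j c) \<alpha>) \<odot> gen k)"
    by (subst sum.swap) (simp only: clifford_mult_assoc coeff_deriv_commute)
  also have "\<dots> = coeff_dirac_right (coeff_dirac_left c) \<alpha>"
    unfolding coeff_dirac_right_def coeff_dirac_left_def[abs_def]
    by (simp add: coeff_deriv_sum coeff_deriv_gen_mult clifford.sum_left)
  finally show "coeff_dirac_left (coeff_dirac_right c) \<alpha> = coeff_dirac_right (coeff_dirac_left c) \<alpha>" .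
qed

lemma coeff_dirac_add:
  "coeff_dirac_left (\<lambda>\<alpha>. c \<alpha> + d \<alpha>) = (\<lambda>\<alpha>. coeff_dirac_left c \<alpha> + coeff_dirac_left d \<alpha>)"
  "coeff_dirac_right (\<lambda>\<alpha>. c \<alpha> + d \<alpha>) = (\<lambda>\<alpha>. coeff_dirac_right c \<alpha> + coeff_dirac_right d \<alpha>)"
  by (simp_all add: coeff_dirac_left_def[abs_def] coeff_dirac_right_def[abs_def] coeff_deriv_add
      clifford.add_left clifford.add_right sum.distrib)

lemma coeff_dirac_scaleR:
  "coeff_dirac_left (\<lambda>\<alpha>. s *\<^sub>R c \<alpha>) = (\<lambda>\<alpha>. s *\<^sub>R coeff_dirac_left c \<alpha>)"
  "coeff_dirac_right (\<lambda>\<alpha>. s *\<^sub>R c \<alpha>) = (\<lambda>\<alpha>. s *\<^sub>R coeff_dirac_right c \<alpha>)"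
  by (simp_all add: coeff_dirac_left_def[abs_def] coeff_dirac_right_def[abs_def]
      coeff_deriv_linear[OF linear_scaleR] clifford.scaleR_left clifford.scaleR_right scaleR_sum_right)

lemma coeff_dirac_sum:
  "coeff_dirac_left (\<lambda>\<alpha>. \<Sum>i\<in>I. c i \<alpha>) = (\<lambda>\<alpha>. \<Sum>i\<in>I. coeff_dirac_left (c i) \<alpha>)"
  "coeff_dirac_right (\<lambda>\<alpha>. \<Sum>i\<in>I. c i \<alpha>) = (\<lambda>\<alpha>. \<Sum>i\<in>I. coeff_dirac_right (c i) \<alpha>)"
  by (auto simp: coeff_dirac_left_def[abs_def] coeff_dirac_right_def[abs_def] coeff_deriv_sum
      clifford.sum_left clifford.sum_right fun_eq_iff intro: sum.swap)

definition coeff_dirac_pow ::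
    "nat \<Rightarrow> nat \<Rightarrow> (('m \<Rightarrow> nat) \<Rightarrow> 'm clifford) \<Rightarrow> ('m \<Rightarrow> nat) \<Rightarrow> 'm::{finite,linorder} clifford" where
  "coeff_dirac_pow p q c = (coeff_dirac_right ^^ q) ((coeff_dirac_left ^^ p) c)"

lemma coeff_dirac_pow_simps:
  "coeff_dirac_pow 0 0 c = c"
  "coeff_dirac_right (coeff_dirac_pow p q c) = coeff_dirac_pow p (Suc q) c"
  "coeff_dirac_left (coeff_dirac_pow p q c) = coeff_dirac_pow (Suc p) q c"
proof -
  show "coeff_dirac_left (coeff_dirac_pow p q c) = coeff_dirac_pow (Suc p) q c"
    unfolding coeff_dirac_pow_def by (induction q) (simp_all add: coeff_dirac_commute)
qed (simp_all add: coeff_dirac_pow_def)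

text \<open>
  The complete homogeneous polynomial $h_{n-1}(L, R) = \sum_{i + j = n - 1} L^i R^j$ of the commuting
  operators $L$ = \<open>coeff_dirac_left\<close> and $R$ = \<open>coeff_dirac_right\<close>.  The index counts the summands,
  so that $n = 0$ gives the empty sum.
\<close>
definition coeff_dirac_hom ::
    "nat \<Rightarrow> (('m \<Rightarrow> nat) \<Rightarrow> 'm clifford) \<Rightarrow> ('m \<Rightarrow> nat) \<Rightarrow> 'm::{finite,linorder} clifford" where
  "coeff_dirac_hom n c \<alpha> = (\<Sum>j<n. coeff_dirac_pow (n - j - 1) j c \<alpha>)"

text \<open>
  This is $h_n = L\, h_{n-1} + R^n$.
\<close>
lemma coeff_dirac_left_hom:
  "coeff_dirac_left (coeff_dirac_hom n c) \<alpha> = coeff_dirac_hom (Suc n) c \<alpha> - coeff_dirac_pow 0 n c \<alpha>"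
  by (simp add: coeff_dirac_hom_def[abs_def] coeff_dirac_sum coeff_dirac_pow_simps Suc_diff_Suc)

text \<open>
  By $h_n = L\, h_{n-1} + R^n$, both $h_{n+1} - L\, h_n$ and $R\, h_n - R L\, h_{n-1}$ equal $R^{n+1}$.
\<close>
lemma coeff_dirac_hom_rec:
  "coeff_dirac_hom (Suc (Suc n)) c \<alpha> = coeff_dirac_left (coeff_dirac_hom (Suc n) c) \<alpha> +
     coeff_dirac_right (coeff_dirac_hom (Suc n) c) \<alpha> -
     coeff_dirac_right (coeff_dirac_left (coeff_dirac_hom n c)) \<alpha>"
proof -
  have "coeff_dirac_hom (Suc n) c =
      (\<lambda>\<alpha>. coeff_dirac_left (coeff_dirac_hom n c) \<alpha> + coeff_dirac_pow 0 n c \<alpha>)"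
    by (simp add: fun_eq_iff coeff_dirac_left_hom)
  then have "coeff_dirac_right (coeff_dirac_hom (Suc n) c) \<alpha> =
      coeff_dirac_right (coeff_dirac_left (coeff_dirac_hom n c)) \<alpha> + coeff_dirac_pow 0 (Suc n) c \<alpha>"
    by (simp add: coeff_dirac_add coeff_dirac_pow_simps)
  then show ?thesis
    by (simp add: coeff_dirac_left_hom)
qed

text \<open>
  The coefficients of $g_n = (-1)^{n+1} (R L\, h_{n-2} A_0 + h_{n-1} A_1)$.  The formula covers $n = 1$,
  where $h_{-1}$ is an empty sum, but not $n = 0$.
\<close>
definition CK_coeffs ::
    "(('m \<Rightarrow> nat) \<Rightarrow> 'm clifford) \<Rightarrow> (('m \<Rightarrow> nat) \<Rightarrow> 'm clifford) \<Rightarrow> nat \<Rightarrow>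
      ('m \<Rightarrow> nat) \<Rightarrow> 'm::{finite,linorder} clifford" where
  "CK_coeffs a b n = (if n = 0 then a else (\<lambda>\<alpha>. (- 1) ^ Suc n *\<^sub>R
     (coeff_dirac_right (coeff_dirac_left (coeff_dirac_hom (n - 1) a)) \<alpha> + coeff_dirac_hom n b \<alpha>)))"

lemma coeff_dirac_hom_0 [simp]: "coeff_dirac_hom 0 c = (\<lambda>\<alpha>. 0)"
  by (simp add: coeff_dirac_hom_def[abs_def])

lemma coeff_dirac_hom_1 [simp]: "coeff_dirac_hom (Suc 0) c = c"
  by (simp add: coeff_dirac_hom_def[abs_def] coeff_dirac_pow_simps)

lemma coeff_dirac_zero [simp]:
  "coeff_dirac_left (\<lambda>\<alpha>. 0) = (\<lambda>\<alpha>. 0)" "coeff_dirac_right (\<lambda>\<alpha>. 0) = (\<lambda>\<alpha>. 0)"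
  using coeff_dirac_scaleR[of 0 "\<lambda>\<alpha>. 0"] by simp_all

lemma CK_coeffs_0 [simp]: "CK_coeffs a b 0 = a"
  and CK_coeffs_1 [simp]: "CK_coeffs a b (Suc 0) = b"
  by (simp_all add: CK_coeffs_def)

text \<open>
  The coefficient form of $\partial_x f \partial_x = 0$.  For $n \ge 1$ it is \<open>coeff_dirac_hom_rec\<close> applied
  to $A_1$ and, after applying $R L$, to $A_0$; the alternating sign exchanges the roots $L, R$ of that
  recursion for $-L, -R$.  The case $n = 0$ is separate because $g_0 = A_0$ does not come from
  the general formula.
\<close>
lemma CK_coeffs_rec:
  "CK_coeffs a b (Suc (Suc n)) \<alpha> + coeff_dirac_left (CK_coeffs a b (Suc n)) \<alpha> +
    coeff_dirac_right (CK_coeffs a b (Suc n)) \<alpha> +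
    coeff_dirac_right (coeff_dirac_left (CK_coeffs a b n)) \<alpha> = 0"
proof (cases n)
  case 0
  then show ?thesis
    using coeff_dirac_hom_rec[of 0 b \<alpha>] by (simp add: CK_coeffs_def algebra_simps)
next
  case (Suc m)
  define T :: "(('a \<Rightarrow> nat) \<Rightarrow> 'a clifford) \<Rightarrow> ('a \<Rightarrow> nat) \<Rightarrow> 'a clifford"
    where "T c = coeff_dirac_right (coeff_dirac_left c)" for c
  have T: "T (\<lambda>\<alpha>. c \<alpha> + d \<alpha>) = (\<lambda>\<alpha>. T c \<alpha> + T d \<alpha>)" "T (\<lambda>\<alpha>. s *\<^sub>R c \<alpha>) = (\<lambda>\<alpha>. s *\<^sub>R T c \<alpha>)" for c d s
    by (simp_all add: T_def coeff_dirac_add coeff_dirac_scaleR)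
  have T_commute: "coeff_dirac_left (T c) = T (coeff_dirac_left c)"
    "coeff_dirac_right (T c) = T (coeff_dirac_right c)" for c
    by (simp_all add: T_def coeff_dirac_commute)
  let ?P = coeff_dirac_hom
  have b: "?P (Suc (Suc (Suc m))) b \<alpha> = coeff_dirac_left (?P (Suc (Suc m)) b) \<alpha> +
      coeff_dirac_right (?P (Suc (Suc m)) b) \<alpha> - T (?P (Suc m) b) \<alpha>"
    unfolding T_def by (rule coeff_dirac_hom_rec)
  have "?P (Suc (Suc m)) a = (\<lambda>\<alpha>. (coeff_dirac_left (?P (Suc m) a) \<alpha> +
      coeff_dirac_right (?P (Suc m) a) \<alpha>) + (- 1) *\<^sub>R T (?P m a) \<alpha>)"
    unfolding T_def by (simp add: fun_eq_iff coeff_dirac_hom_rec)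
  then have a: "T (?P (Suc (Suc m)) a) \<alpha> = T (coeff_dirac_left (?P (Suc m) a)) \<alpha> +
      T (coeff_dirac_right (?P (Suc m) a)) \<alpha> - T (T (?P m a)) \<alpha>"
    by (simp only: T) simp
  define V where "V n = (\<lambda>\<alpha>. T (?P n a) \<alpha> + ?P (Suc n) b \<alpha>)" for n
  have "V (Suc (Suc m)) \<alpha> = coeff_dirac_left (V (Suc m)) \<alpha> + coeff_dirac_right (V (Suc m)) \<alpha> -
      T (V m) \<alpha>"
    by (simp add: V_def T coeff_dirac_add T_commute a b)
  moreover have "CK_coeffs a b (Suc n) = (\<lambda>\<alpha>. (- 1) ^ n *\<^sub>R V n \<alpha>)" for n
    by (simp add: CK_coeffs_def T_def V_def)
  ultimately show ?thesis
    unfolding T_def[symmetric] Suc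
    by (simp only: T coeff_dirac_scaleR) (simp add: algebra_simps)
qed

section \<open>Growth of iterated Dirac operators\<close>

text \<open>
  The estimate satisfied by a first order operator with constant coefficients on the scale of
  norms $\sum_\alpha |c_\alpha| \rho^{|\alpha|}$.
\<close>
definition loses_derivative ::
    "real \<Rightarrow> ((('m \<Rightarrow> nat) \<Rightarrow> 'b) \<Rightarrow> ('m::finite \<Rightarrow> nat) \<Rightarrow> 'b::real_normed_vector) \<Rightarrow> bool" where
  "loses_derivative K T \<longleftrightarrow> 0 \<le> K \<and> (\<forall>\<rho> \<sigma> c M. majorized \<rho> c M \<longrightarrow> 0 \<le> \<sigma> \<longrightarrow> \<sigma> < \<rho> \<longrightarrow>
     majorized \<sigma> (T c) (K * M / (\<rho> - \<sigma>)))"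

lemma coeff_dirac_loses_derivative:
  obtains K where "0 < K" "loses_derivative K (coeff_dirac_left :: _ \<Rightarrow> ('m \<Rightarrow> nat) \<Rightarrow> 'm::{finite,linorder} clifford)"
    "loses_derivative K (coeff_dirac_right :: _ \<Rightarrow> ('m \<Rightarrow> nat) \<Rightarrow> 'm::{finite,linorder} clifford)"
proof -
  obtain B where B: "0 < B" "\<And>x y :: 'm clifford. norm (x \<odot> y) \<le> norm x * norm y * B"
    using clifford.pos_bounded by blast
  have norm_gen: "norm (gen j :: 'm clifford) = 1" for j
    by (simp add: blade_def norm_axis_1)
  define K where "K = real CARD('m) * B"
  have "majorized \<sigma> (coeff_dirac_left c) (K * M / (\<rho> - \<sigma>)) \<and>
      majorized \<sigma> (coeff_dirac_right c) (K * M / (\<rho> - \<sigma>))"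
    if "majorized \<rho> c M" "0 \<le> \<sigma>" "\<sigma> < \<rho>" for c :: "('m \<Rightarrow> nat) \<Rightarrow> 'm clifford" and \<rho> \<sigma> M
  proof -
    note D = majorized_coeff_deriv[OF that]
    have *: "(\<Sum>j\<in>(UNIV :: 'm set). B * (M / (\<rho> - \<sigma>))) = K * M / (\<rho> - \<sigma>)"
      by (simp add: K_def)
    show ?thesis
      unfolding coeff_dirac_left_def[abs_def] coeff_dirac_right_def[abs_def] *[symmetric]
      using B that(2) D
      by (intro conjI majorized_sum majorized_linear[where h = "\<lambda>x. gen _ \<odot> x"]
          majorized_linear[where h = "\<lambda>x. x \<odot> gen _"])
        (auto simp: norm_gen mult.commute intro: order_trans[OF B(2)])
  qed
  moreover have "0 < K"
    using B by (simp add: K_def)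
  ultimately show ?thesis
    by (intro that[of K]) (auto simp: loses_derivative_def)
qed

text \<open>
  Each application of \<open>T\<close> spends a piece $\epsilon$ of the radius and costs a factor $K / \epsilon$.
\<close>
lemma majorized_funpow:
  assumes T: "loses_derivative K T" and c: "majorized \<rho> c M" and "0 < \<epsilon>" "real n * \<epsilon> \<le> \<rho>"
  shows "majorized (\<rho> - real n * \<epsilon>) ((T ^^ n) c) (M * (K / \<epsilon>) ^ n)"
  using assms(4)
proof (induction n)
  case 0
  then show ?case using c by simp
next
  case (Suc n)
  have "majorized (\<rho> - real n * \<epsilon>) ((T ^^ n) c) (M * (K / \<epsilon>) ^ n)"
    using Suc \<open>0 < \<epsilon>\<close> by (intro Suc.IH) (simp add: algebra_simps)
  moreover have "0 \<le> \<rho> - real (Suc n) * \<epsilon>" "\<rho> - real (Suc n) * \<epsilon> < \<rho> - real n * \<epsilon>"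
    using Suc.prems \<open>0 < \<epsilon>\<close> by (auto simp: algebra_simps)
  ultimately have "majorized (\<rho> - real (Suc n) * \<epsilon>) (T ((T ^^ n) c))
      (K * (M * (K / \<epsilon>) ^ n) / ((\<rho> - real n * \<epsilon>) - (\<rho> - real (Suc n) * \<epsilon>)))"
    using T unfolding loses_derivative_def by blast
  then show ?case
    by (simp add: algebra_simps)
qed

text \<open>
  The left-hand side divided by $n!$ is one of the nonnegative terms of the series of $e^n$.
\<close>
lemma power_self_le_exp_fact: "real n ^ n \<le> exp 1 ^ n * fact n"
proof -
  have "real n ^ n / fact n \<le> exp (real n)"
    using sum_le_suminf[OF summable_exp[of "real n"], of "{n}"]
    by (simp add: exp_def divide_inverse mult.commute)
  then show ?thesis
    by (simp add: exp_of_nat_mult[of n "1::real", simplified] divide_le_eq)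
qed

text \<open>
  Splitting the radius $\rho / 2$ into $n = p + q$ equal steps costs $(2 n K / \rho)^n$, and
  $n^n \le e^n n!$.
\<close>
lemma coeff_dirac_pow_majorized:
  assumes "0 < \<rho>"
  obtains Q where "1 \<le> Q" "\<And>p q M (a :: ('m::{finite,linorder} \<Rightarrow> nat) \<Rightarrow> 'm clifford). majorized \<rho> a M \<Longrightarrow>
    majorized (\<rho> / 2) (coeff_dirac_pow p q a) (M * fact (p + q) * Q ^ (p + q))"
proof -
  obtain K where K: "0 < K" "loses_derivative K (coeff_dirac_left :: _ \<Rightarrow> ('m \<Rightarrow> nat) \<Rightarrow> 'm clifford)"
    "loses_derivative K (coeff_dirac_right :: _ \<Rightarrow> ('m \<Rightarrow> nat) \<Rightarrow> 'm clifford)"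
    using coeff_dirac_loses_derivative by blast
  define Q where "Q = max 1 (2 * K / \<rho> * exp 1)"
  have "majorized (\<rho> / 2) (coeff_dirac_pow p q a) (M * fact (p + q) * Q ^ (p + q))"
    if a: "majorized \<rho> a M" for p q M and a :: "('m \<Rightarrow> nat) \<Rightarrow> 'm clifford"
  proof (cases "p + q = 0")
    case True
    then show ?thesis
      using a assms by (auto simp: coeff_dirac_pow_def intro: majorized_mono)
  next
    case False
    define \<epsilon> where "\<epsilon> = \<rho> / (2 * real (p + q))"
    have "real (p + q) * \<epsilon> = \<rho> / 2"
      using False by (simp add: \<epsilon>_def del: of_nat_add)
    then have "real p * \<epsilon> + real q * \<epsilon> = \<rho> / 2"
      by (simp add: distrib_right)
    moreover have "0 < \<epsilon>"
      using False assms by (simp add: \<epsilon>_def del: of_nat_add)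
    ultimately have \<epsilon>: "0 < \<epsilon>" "real p * \<epsilon> + real q * \<epsilon> = \<rho> / 2"
      by simp_all
    have qe: "0 \<le> real q * \<epsilon>"
      using \<epsilon>(1) by simp
    have "majorized (\<rho> - real p * \<epsilon>) ((coeff_dirac_left ^^ p) a) (M * (K / \<epsilon>) ^ p)"
      using \<epsilon> assms qe by (intro majorized_funpow[OF K(2) a]) linarith+
    then have "majorized (\<rho> - real p * \<epsilon> - real q * \<epsilon>) (coeff_dirac_pow p q a)
        (M * (K / \<epsilon>) ^ p * (K / \<epsilon>) ^ q)"
      unfolding coeff_dirac_pow_def using \<epsilon> assms by (intro majorized_funpow[OF K(3)]) linarith+
    also have "\<rho> - real p * \<epsilon> - real q * \<epsilon> = \<rho> / 2"
      using \<epsilon>(2) by linarith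
    finally have 1: "majorized (\<rho> / 2) (coeff_dirac_pow p q a) (M * (K / \<epsilon>) ^ (p + q))"
      by (simp add: power_add mult.assoc)
    have "(K / \<epsilon>) ^ (p + q) = (2 * K / \<rho>) ^ (p + q) * real (p + q) ^ (p + q)"
      by (simp add: \<epsilon>_def power_mult_distrib[symmetric] mult_ac)
    also have "\<dots> \<le> (2 * K / \<rho>) ^ (p + q) * (exp 1 ^ (p + q) * fact (p + q))"
      using K assms by (intro mult_left_mono power_self_le_exp_fact) auto
    also have "\<dots> = fact (p + q) * (2 * K / \<rho> * exp 1) ^ (p + q)"
      by (simp only: power_mult_distrib mult_ac)
    also have "\<dots> \<le> fact (p + q) * Q ^ (p + q)"
      using K assms by (intro mult_left_mono power_mono) (auto simp: Q_def)
    finally have "M * (K / \<epsilon>) ^ (p + q) \<le> M * (fact (p + q) * Q ^ (p + q))"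
      using majorized_nonneg[OF a] by (rule mult_left_mono)
    then show ?thesis
      using assms by (intro majorized_mono[OF 1]) (auto simp: mult.assoc)
  qed
  moreover have "1 \<le> Q"
    by (simp add: Q_def)
  ultimately show ?thesis
    using that by blast
qed

lemma coeff_dirac_right_left_hom:
  "coeff_dirac_right (coeff_dirac_left (coeff_dirac_hom n c)) \<alpha> =
    (\<Sum>j<n. coeff_dirac_pow (n - j) (j + 1) c \<alpha>)"
  by (simp add: coeff_dirac_hom_def[abs_def] coeff_dirac_sum coeff_dirac_pow_simps Suc_diff_Suc)

text \<open>
  For $n \ge 1$ the family $g_n$ is, up to sign, a sum of fewer than $2 n$ terms $L^i R^j A_0$ with $i + j = n$ or
  $L^i R^j A_1$ with $i + j = n - 1$.
\<close>
lemma CK_coeffs_majorized: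
  assumes "0 < \<rho>"
  obtains Q where "1 \<le> Q" "\<And>n M (a :: ('m::{finite,linorder} \<Rightarrow> nat) \<Rightarrow> 'm clifford) b.
    majorized \<rho> a M \<Longrightarrow> majorized \<rho> b M \<Longrightarrow> majorized (\<rho> / 2) (CK_coeffs a b n) (M * fact n * Q ^ n)"
proof -
  obtain Q where Q: "1 \<le> Q" and W: "\<And>p q M (a :: ('m \<Rightarrow> nat) \<Rightarrow> 'm clifford). majorized \<rho> a M \<Longrightarrow>
    majorized (\<rho> / 2) (coeff_dirac_pow p q a) (M * fact (p + q) * Q ^ (p + q))"
    using coeff_dirac_pow_majorized[OF assms] by metis
  have "majorized (\<rho> / 2) (CK_coeffs a b n) (M * fact n * (2 * Q) ^ n)"
    if ab: "majorized \<rho> a M" "majorized \<rho> b M" for n M and a b :: "('m \<Rightarrow> nat) \<Rightarrow> 'm clifford"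
  proof (cases n)
    case 0
    then show ?thesis
      using ab assms by (auto intro: majorized_mono)
  next
    case (Suc m)
    have M: "0 \<le> M"
      using ab majorized_nonneg by blast
    have "majorized (\<rho> / 2) (\<lambda>\<alpha>. \<Sum>j<m. coeff_dirac_pow (m - j) (j + 1) a \<alpha>)
        (\<Sum>j<m. M * fact n * Q ^ n)"
    proof (rule majorized_sum)
      fix j assume "j \<in> {..<m}"
      then have "m - j + (j + 1) = n"
        using Suc by simp
      then show "majorized (\<rho> / 2) (coeff_dirac_pow (m - j) (j + 1) a) (M * fact n * Q ^ n)"
        using W[OF ab(1), of "m - j" "j + 1"] by simp
    qed (use assms in auto)
    moreover have "majorized (\<rho> / 2) (\<lambda>\<alpha>. \<Sum>j<n. coeff_dirac_pow (n - j - 1) j b \<alpha>)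
        (\<Sum>j<n. M * fact m * Q ^ m)"
    proof (rule majorized_sum)
      fix j assume "j \<in> {..<n}"
      then have "n - j - 1 + j = m"
        using Suc by simp
      then show "majorized (\<rho> / 2) (coeff_dirac_pow (n - j - 1) j b) (M * fact m * Q ^ m)"
        using W[OF ab(2), of "n - j - 1" j] by simp
    qed (use assms in auto)
    ultimately have 1: "majorized (\<rho> / 2)
        (\<lambda>\<alpha>. coeff_dirac_right (coeff_dirac_left (coeff_dirac_hom m a)) \<alpha> + coeff_dirac_hom n b \<alpha>)
        ((\<Sum>j<m. M * fact n * Q ^ n) + (\<Sum>j<n. M * fact m * Q ^ m))"
      unfolding coeff_dirac_right_left_hom coeff_dirac_hom_def using assms
      by (intro majorized_add) auto
    have 2: "majorized (\<rho> / 2) (CK_coeffs a b n)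
        (1 * ((\<Sum>j<m. M * fact n * Q ^ n) + (\<Sum>j<n. M * fact m * Q ^ m)))"
    proof -
      have "CK_coeffs a b n = (\<lambda>\<alpha>. (- 1) ^ Suc n *\<^sub>R
          (coeff_dirac_right (coeff_dirac_left (coeff_dirac_hom m a)) \<alpha> + coeff_dirac_hom n b \<alpha>))"
        by (simp add: CK_coeffs_def Suc)
      then show ?thesis
        using majorized_linear[OF 1, of "\<lambda>x. (- 1) ^ Suc n *\<^sub>R x" 1] assms by simp
    qed
    \<comment> \<open>The sum over $A_1$ has $n$ terms with $(n-1)!$, so it counts as a single term with
      $n!$; the resulting number $n$ of terms is absorbed by replacing $Q$ with $2 Q$.\<close>
    have "(\<Sum>j<m. M * fact n * Q ^ n) + (\<Sum>j<n. M * fact m * Q ^ m) =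
        real m * (M * fact n * Q ^ n) + M * fact n * Q ^ m"
      by (simp add: Suc algebra_simps)
    also have "\<dots> \<le> real m * (M * fact n * Q ^ n) + M * fact n * Q ^ n"
      using M Q Suc by (intro add_left_mono mult_left_mono power_increasing) auto
    also have "\<dots> = real n * (M * fact n * Q ^ n)"
      by (simp add: Suc algebra_simps)
    also have "\<dots> \<le> 2 ^ n * (M * fact n * Q ^ n)"
      using M Q by (intro mult_right_mono) (auto simp: less_imp_le of_nat_less_two_power)
    also have "\<dots> = M * fact n * (2 * Q) ^ n"
      by (simp add: power_mult_distrib)
    finally show ?thesis
      using assms by (intro majorized_mono[OF 2]) auto
  qed
  then show ?thesis
    using that[of "2 * Q"] Q by auto
qed

section \<open>Exponential generating series in one more variable\<close>

text \<open>
  The coefficients of $\sum_n \frac{x_0^n}{n!} g_n$ as a power series in $x_0$ and the variables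
  of the $g_n$; the added variable $x_0$ has the index \<open>None\<close>.
\<close>
definition exp_coeffs ::
    "(nat \<Rightarrow> ('k \<Rightarrow> nat) \<Rightarrow> 'b) \<Rightarrow> ('k option \<Rightarrow> nat) \<Rightarrow> 'b::real_normed_vector" where
  "exp_coeffs g \<beta> = (1 / fact (\<beta> None)) *\<^sub>R g (\<beta> None) (\<lambda>i. \<beta> (Some i))"

text \<open>
  Because of the factorials, the derivative in $x_0$ is a shift of the sequence.
\<close>
lemma coeff_deriv_exp_coeffs_None: "coeff_deriv None (exp_coeffs g) = exp_coeffs (\<lambda>n. g (Suc n))"
  by (auto simp: coeff_deriv_def exp_coeffs_def fun_eq_iff simp del: of_nat_Suc)

lemma coeff_deriv_exp_coeffs_Some:
  "coeff_deriv (Some i) (exp_coeffs g) = exp_coeffs (\<lambda>n. coeff_deriv i (g n))"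
proof
  fix \<beta> :: "'a option \<Rightarrow> nat"
  have "(\<lambda>j. (\<beta>(Some i := Suc (\<beta> (Some i)))) (Some j)) =
      (\<lambda>j. \<beta> (Some j))(i := Suc (\<beta> (Some i)))"
    by auto
  then show "coeff_deriv (Some i) (exp_coeffs g) \<beta> = exp_coeffs (\<lambda>n. coeff_deriv i (g n)) \<beta>"
    by (simp add: coeff_deriv_def exp_coeffs_def)
qed

lemma bij_case_option: "bij (\<lambda>(n, \<alpha>). case_option n \<alpha> :: 'k option \<Rightarrow> 'c)"
proof (rule o_bij)
  show "(\<lambda>\<beta>. (\<beta> None, \<lambda>i. \<beta> (Some i))) \<circ> (\<lambda>(n, \<alpha>). case_option n \<alpha>) = (id :: 'c \<times> ('k \<Rightarrow> 'c) \<Rightarrow> _)"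
    by auto
  show "(\<lambda>(n, \<alpha>). case_option n \<alpha>) \<circ> (\<lambda>\<beta>. (\<beta> None, \<lambda>i. \<beta> (Some i))) = (id :: ('k option \<Rightarrow> 'c) \<Rightarrow> _)"
    by (auto simp: fun_eq_iff split: option.split)
qed

lemma sum_option: "sum \<beta> (UNIV :: 'k::finite option set) = \<beta> None + (\<Sum>i\<in>UNIV. \<beta> (Some i))"
  by (simp add: UNIV_option_conv sum.reindex)

lemma monomial_option: "monomial (case_option x X) (case_option n \<alpha>) = x ^ n * monomial X \<alpha>"
  by (simp add: monomial_def UNIV_option_conv prod.reindex)

text \<open>
  A finite set of indices is contained in a rectangle $\{0, \dots, N\} \times G$, over which the sum
  factors.
\<close>
lemma majorized_exp_coeffs:
  fixes g :: "nat \<Rightarrow> ('k::finite \<Rightarrow> nat) \<Rightarrow> 'b::real_normed_vector"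
  assumes "\<And>n. majorized \<rho> (g n) (C n)" "0 \<le> \<rho>" "\<And>N. (\<Sum>n\<le>N. \<rho> ^ n / fact n * C n) \<le> M"
  shows "majorized \<rho> (exp_coeffs g) M"
proof (rule majorizedI)
  fix F :: "('k option \<Rightarrow> nat) set"
  assume F: "finite F"
  define N where "N = Max ((\<lambda>\<beta>. \<beta> None) ` F)"
  define G where "G = (\<lambda>\<beta> i. \<beta> (Some i)) ` F"
  let ?f = "\<lambda>(n, \<alpha>). case_option n \<alpha> :: 'k option \<Rightarrow> nat"
  have "F \<subseteq> ?f ` ({..N} \<times> G)"
  proof
    fix \<beta> assume "\<beta> \<in> F"
    then have "\<beta> = ?f (\<beta> None, \<lambda>i. \<beta> (Some i))" "(\<beta> None, \<lambda>i. \<beta> (Some i)) \<in> {..N} \<times> G"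
      using F by (auto simp: N_def G_def fun_eq_iff split: option.split)
    then show "\<beta> \<in> ?f ` ({..N} \<times> G)"
      by blast
  qed
  moreover have "finite G"
    using F by (simp add: G_def)
  ultimately have "(\<Sum>\<beta>\<in>F. norm (exp_coeffs g \<beta>) * \<rho> ^ sum \<beta> UNIV) \<le>
      (\<Sum>\<beta>\<in>?f ` ({..N} \<times> G). norm (exp_coeffs g \<beta>) * \<rho> ^ sum \<beta> UNIV)"
    using assms(2) by (intro sum_mono2) auto
  also have "\<dots> = (\<Sum>(n, \<alpha>)\<in>{..N} \<times> G. norm (exp_coeffs g (case_option n \<alpha>)) * \<rho> ^ sum (case_option n \<alpha>) UNIV)"
    by (subst sum.reindex[OF inj_on_subset[OF bij_is_inj[OF bij_case_option]]])
      (auto simp: case_prod_beta)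
  also have "\<dots> = (\<Sum>n\<le>N. \<rho> ^ n / fact n * (\<Sum>\<alpha>\<in>G. norm (g n \<alpha>) * \<rho> ^ sum \<alpha> UNIV))"
    by (simp add: sum.cartesian_product[symmetric] exp_coeffs_def sum_option power_add
        sum_distrib_left mult_ac)
  also have "\<dots> \<le> (\<Sum>n\<le>N. \<rho> ^ n / fact n * C n)"
    using assms \<open>finite G\<close> by (intro sum_mono mult_left_mono majorizedD) auto
  also have "\<dots> \<le> M"
    by (rule assms)
  finally show "(\<Sum>\<beta>\<in>F. norm (exp_coeffs g \<beta>) * \<rho> ^ sum \<beta> UNIV) \<le> M" .
qed

lemma power_series_exp_coeffs:
  assumes "convergent_below \<rho> (exp_coeffs g)" "\<And>n. convergent_below \<rho> (g n)"
    and "\<bar>x\<bar> < \<rho>" "\<And>i. \<bar>X i\<bar> < \<rho>"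
  shows "(\<lambda>n. (x ^ n / fact n) *\<^sub>R power_series (g n) X) sums
    power_series (exp_coeffs g) (case_option x X)"
proof (rule has_sum_imp_sums)
  have "\<bar>case_option x X k\<bar> < \<rho>" for k
    using assms by (auto split: option.split)
  then have "((\<lambda>\<beta>. monomial (case_option x X) \<beta> *\<^sub>R exp_coeffs g \<beta>) has_sum
      power_series (exp_coeffs g) (case_option x X)) UNIV"
    using assms(1) by (intro power_series_has_sum)
  then have "((\<lambda>(n, \<alpha>). (x ^ n / fact n) *\<^sub>R (monomial X \<alpha> *\<^sub>R g n \<alpha>)) has_sum
      power_series (exp_coeffs g) (case_option x X)) (UNIV \<times> UNIV)"
    by (subst (asm) has_sum_reindex_bij_betw[OF bij_case_option, symmetric])
      (simp add: case_prod_unfold monomial_option exp_coeffs_def mult_ac)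
  then show "((\<lambda>n. (x ^ n / fact n) *\<^sub>R power_series (g n) X) has_sum
      power_series (exp_coeffs g) (case_option x X)) UNIV"
  proof (rule has_sum_SigmaD)
    fix n
    show "((\<lambda>\<alpha>. case (n, \<alpha>) of (n, \<alpha>) \<Rightarrow> (x ^ n / fact n) *\<^sub>R (monomial X \<alpha> *\<^sub>R g n \<alpha>)) has_sum
        (x ^ n / fact n) *\<^sub>R power_series (g n) X) UNIV"
      using has_sum_scaleR[OF power_series_has_sum[where c = "g n" and X = X, OF assms(2,4)],
          of "x ^ n / fact n"]
      by (simp add: mult_ac)
  qed
qed

section \<open>Functions with a power series expansion\<close>
text \<open>
  Here \<open>X\<close> sends a point to its coordinates relative to the centre of the expansion.  Keeping \<open>X\<close>
  abstract treats functions on $\mathbb R^m$ and on $\mathbb R^{m+1}$ alike.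
\<close>
definition has_expansion ::
    "('a::real_normed_vector \<Rightarrow> 'b::banach) \<Rightarrow> 'a set \<Rightarrow> ('a \<Rightarrow> 'k::finite \<Rightarrow> real) \<Rightarrow> real \<Rightarrow>
      (('k \<Rightarrow> nat) \<Rightarrow> 'b) \<Rightarrow> bool" where
  "has_expansion f U X \<rho> c \<longleftrightarrow> open U \<and> convergent_below \<rho> c \<and>
     (\<forall>y\<in>U. (\<forall>k. \<bar>X y k\<bar> < \<rho>) \<and> f y = power_series c (X y))"

lemma has_expansionD:
  assumes "has_expansion f U X \<rho> c"
  shows "open U" "convergent_below \<rho> c"
    "y \<in> U \<Longrightarrow> \<bar>X y k\<bar> < \<rho>" "y \<in> U \<Longrightarrow> f y = power_series c (X y)"
  using assms by (auto simp: has_expansion_def)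

lemma has_expansion_add:
  assumes "has_expansion f U X \<rho> c" "has_expansion g U X \<rho> d"
  shows "has_expansion (\<lambda>y. f y + g y) U X \<rho> (\<lambda>\<alpha>. c \<alpha> + d \<alpha>)"
  using assms unfolding has_expansion_def
  by (auto simp: convergent_below_add power_series_add)

lemma has_expansion_sum:
  assumes "\<And>i. i \<in> I \<Longrightarrow> has_expansion (f i) U X \<rho> (c i)" "I \<noteq> {}"
  shows "has_expansion (\<lambda>y. \<Sum>i\<in>I. f i y) U X \<rho> (\<lambda>\<alpha>. \<Sum>i\<in>I. c i \<alpha>)"
  unfolding has_expansion_def
proof (intro conjI ballI allI)
  obtain i where "i \<in> I"
    using assms(2) by blast
  then show "open U"
    using has_expansionD(1)[OF assms(1)] by blast
  show X: "\<bar>X y k\<bar> < \<rho>" if "y \<in> U" for y k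
    using has_expansionD(3)[OF assms(1)[OF \<open>i \<in> I\<close>] that] .
  show "convergent_below \<rho> (\<lambda>\<alpha>. \<Sum>i\<in>I. c i \<alpha>)"
    using has_expansionD(2)[OF assms(1)] by (rule convergent_below_sum)
  show "(\<Sum>i\<in>I. f i y) = power_series (\<lambda>\<alpha>. \<Sum>i\<in>I. c i \<alpha>) (X y)" if "y \<in> U" for y
    using has_expansionD(2,4)[OF assms(1)] X[OF that] that
    by (subst power_series_sum[of I \<rho>]) auto
qed

lemma has_expansion_linear:
  assumes "has_expansion f U X \<rho> c" "bounded_linear h"
  shows "has_expansion (\<lambda>y. h (f y)) U X \<rho> (\<lambda>\<alpha>. h (c \<alpha>))"
  using assms unfolding has_expansion_def
  by (auto simp: convergent_below_linear power_series_linear)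

text \<open>
  The direction \<open>v\<close> is the one that moves the \<open>k\<close>-th coordinate alone and at unit speed.
\<close>
lemma has_expansion_derivative:
  assumes f: "has_expansion f U X \<rho> c" and x: "x \<in> U"
    and v: "\<And>x t. X (x + t *\<^sub>R v) = (X x)(k := X x k + t)"
  shows "((\<lambda>t. f (x + t *\<^sub>R v)) has_vector_derivative power_series (coeff_deriv k c) (X x)) (at 0)"
proof -
  have U: "open ((\<lambda>t. x + t *\<^sub>R v) -` U)"
    using has_expansionD(1)[OF f] by (intro open_vimage continuous_intros)
  have *: "((\<lambda>t. power_series c ((X x)(k := X x k + t))) has_vector_derivative
      power_series (coeff_deriv k c) (X x)) (at 0)"
    using has_expansionD(2,3)[OF f] x by (intro power_series_has_vector_derivative)
  show ?thesis
    by (rule has_vector_derivative_transform_within_open[OF * U])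
      (use x has_expansionD(4)[OF f] v in auto)
qed

lemma has_expansion_partial:
  assumes f: "has_expansion f U X \<rho> c"
    and v: "\<And>x t. X (x + t *\<^sub>R v) = (X x)(k := X x k + t)"
  shows "has_expansion (partial v f) U X \<rho> (coeff_deriv k c)"
  unfolding has_expansion_def partial_def
  using has_expansionD[OF f] convergent_below_coeff_deriv
    vector_derivative_at[OF has_expansion_derivative[OF f _ v]]
  by blast

section \<open>Dirac and Cauchy--Riemann operators on expansions\<close>
definition offset :: "real ^ 'm \<Rightarrow> real ^ 'm \<Rightarrow> 'm \<Rightarrow> real" where
  "offset a x i = x $ i - a $ i"

definition offset1 :: "real ^ 'm \<Rightarrow> 'm::finite Rm1 \<Rightarrow> 'm option \<Rightarrow> real" where
  "offset1 a p = case_option (fst p) (offset a (snd p))"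

lemma open_offset_box: "open {x. \<forall>i. \<bar>offset a x i\<bar> < \<rho>}"
  unfolding Collect_all_eq offset_def
  by (intro open_INT ballI open_Collect_less continuous_intros) auto

text \<open>
  The Euclidean norm is at most the sum of the $m$ coordinates; the denominator $m + 1$ makes the
  resulting inequality strict.
\<close>
lemma offset_le_imp_mem_ball:
  fixes a :: "real ^ 'm::finite"
  assumes "\<And>i. \<bar>offset a x i\<bar> \<le> \<rho>" "\<rho> \<le> r / (real CARD('m) + 1)" "0 < r"
  shows "x \<in> ball a r"
proof -
  have "norm (x - a) \<le> (\<Sum>i\<in>UNIV. \<bar>(x - a) $ i\<bar>)"
    by (rule norm_le_l1_cart)
  also have "\<dots> \<le> (\<Sum>i\<in>(UNIV :: 'm set). r / (real CARD('m) + 1))"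
    using order_trans[OF assms(1,2)] by (intro sum_mono) (simp add: offset_def)
  also have "\<dots> < r"
    using assms(3) by (simp add: field_simps)
  finally show ?thesis
    by (simp add: dist_norm norm_minus_commute)
qed

lemma offset_axis: "offset a (x + t *\<^sub>R axis j 1) = (offset a x)(j := offset a x j + t)"
  by (auto simp: offset_def axis_def fun_eq_iff)

lemma offset1_axis:
  "offset1 a (p + t *\<^sub>R (1, 0)) = (offset1 a p)(None := offset1 a p None + t)"
  "offset1 a (p + t *\<^sub>R (0, axis j 1)) = (offset1 a p)(Some j := offset1 a p (Some j) + t)"
  by (auto simp: offset1_def offset_def axis_def fun_eq_iff split: option.split)

lemma has_expansion_dirac:
  assumes "has_expansion f U (offset a) \<rho> c"
  shows "has_expansion (dirac_left f) U (offset a) \<rho> (coeff_dirac_left c)"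
    and "has_expansion (dirac_right f) U (offset a) \<rho> (coeff_dirac_right c)"
proof -
  have D: "has_expansion (partial (axis j 1) f) U (offset a) \<rho> (coeff_deriv j c)" for j
    using assms offset_axis by (rule has_expansion_partial)
  show "has_expansion (dirac_left f) U (offset a) \<rho> (coeff_dirac_left c)"
    unfolding dirac_left_def[abs_def] coeff_dirac_left_def[abs_def]
    by (intro has_expansion_sum has_expansion_linear[OF D] clifford.bounded_linear_right) auto
  show "has_expansion (dirac_right f) U (offset a) \<rho> (coeff_dirac_right c)"
    unfolding dirac_right_def[abs_def] coeff_dirac_right_def[abs_def]
    by (intro has_expansion_sum has_expansion_linear[OF D] clifford.bounded_linear_left) auto
qed

lemma has_expansion_dirac_pow:
  assumes "has_expansion f U (offset a) \<rho> c"
  shows "has_expansion (dirac_pow p q f) U (offset a) \<rho> (coeff_dirac_pow p q c)"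
proof -
  have L: "has_expansion ((dirac_left ^^ p) f) U (offset a) \<rho> ((coeff_dirac_left ^^ p) c)"
    using assms by (induction p) (auto intro: has_expansion_dirac)
  then show ?thesis
    unfolding dirac_pow_def coeff_dirac_pow_def by (induction q) (auto intro: has_expansion_dirac)
qed

lemma coeff_dirac_exp_coeffs:
  "(\<Sum>j\<in>UNIV. gen j \<odot> coeff_deriv (Some j) (exp_coeffs g) \<beta>) =
    exp_coeffs (\<lambda>n. coeff_dirac_left (g n)) \<beta>"
  "(\<Sum>j\<in>UNIV. coeff_deriv (Some j) (exp_coeffs g) \<beta> \<odot> gen j) =
    exp_coeffs (\<lambda>n. coeff_dirac_right (g n)) \<beta>"
  by (simp_all add: coeff_deriv_exp_coeffs_Some exp_coeffs_def coeff_dirac_left_def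
      coeff_dirac_right_def clifford.scaleR_left clifford.scaleR_right scaleR_sum_right)

text \<open>
  On the sequences $(g_n)$ the operators $\partial_x \cdot$ and $\cdot\, \partial_x$ act as \<open>shift + L\<close> and
  \<open>shift + R\<close>, which turns the differential equation into a recursion for the sequence.
\<close>
lemma has_expansion_cr:
  assumes "has_expansion f U (offset1 a) \<rho> (exp_coeffs g)"
  shows "has_expansion (cr_left f) U (offset1 a) \<rho>
      (exp_coeffs (\<lambda>n \<alpha>. g (Suc n) \<alpha> + coeff_dirac_left (g n) \<alpha>))" (is ?L)
    and "has_expansion (cr_right f) U (offset1 a) \<rho>
      (exp_coeffs (\<lambda>n \<alpha>. g (Suc n) \<alpha> + coeff_dirac_right (g n) \<alpha>))" (is ?R)
proof -
  have D0: "has_expansion (partial (1, 0) f) U (offset1 a) \<rho> (coeff_deriv None (exp_coeffs g))"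
    using assms offset1_axis(1) by (rule has_expansion_partial)
  have D: "has_expansion (partial (0, axis j 1) f) U (offset1 a) \<rho>
      (coeff_deriv (Some j) (exp_coeffs g))" for j
    using assms offset1_axis(2) by (rule has_expansion_partial)
  have L: "exp_coeffs (\<lambda>n \<alpha>. g (Suc n) \<alpha> + coeff_dirac_left (g n) \<alpha>) =
      (\<lambda>\<beta>. coeff_deriv None (exp_coeffs g) \<beta> +
        (\<Sum>j\<in>UNIV. gen j \<odot> coeff_deriv (Some j) (exp_coeffs g) \<beta>))"
    by (simp add: coeff_dirac_exp_coeffs coeff_deriv_exp_coeffs_None)
      (simp add: exp_coeffs_def fun_eq_iff scaleR_add_right)
  have R: "exp_coeffs (\<lambda>n \<alpha>. g (Suc n) \<alpha> + coeff_dirac_right (g n) \<alpha>) =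
      (\<lambda>\<beta>. coeff_deriv None (exp_coeffs g) \<beta> +
        (\<Sum>j\<in>UNIV. coeff_deriv (Some j) (exp_coeffs g) \<beta> \<odot> gen j))"
    by (simp add: coeff_dirac_exp_coeffs coeff_deriv_exp_coeffs_None)
      (simp add: exp_coeffs_def fun_eq_iff scaleR_add_right)
  show ?L
    unfolding cr_left_def[abs_def] L
    by (intro has_expansion_add D0 has_expansion_sum has_expansion_linear[OF D]
        clifford.bounded_linear_right) auto
  show ?R
    unfolding cr_right_def[abs_def] R
    by (intro has_expansion_add D0 has_expansion_sum has_expansion_linear[OF D]
        clifford.bounded_linear_left) auto
qed

text \<open>
  Functions with an expansion are continuous, and their partial derivatives have expansions on the
  same set.
\<close>
lemma has_expansion_Ck_on:
  fixes f :: "'m::finite Rm1 \<Rightarrow> real"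
  assumes "has_expansion f U (offset1 a) \<rho> c"
  shows "Ck_on n f U"
  using assms
proof (induction n arbitrary: f c)
  have cont: "continuous_on U f" if f: "has_expansion f U (offset1 a) \<rho> c"
    for f :: "'m Rm1 \<Rightarrow> real" and c
  proof -
    have "continuous_on UNIV (\<lambda>y. offset1 a y k)" for k
      by (cases k) (auto simp: offset1_def offset_def intro!: continuous_intros)
    then have "isCont (\<lambda>y. power_series c (offset1 a y)) x" if "x \<in> U" for x
      by (rule power_series_isCont[where X = "offset1 a", OF has_expansionD(2)[OF f] has_expansionD(3)[OF f that]])
    then have "continuous_on U (\<lambda>y. power_series c (offset1 a y))"
      by (simp add: continuous_at_imp_continuous_on)
    then show ?thesis
      using has_expansionD(4)[OF f] by (simp cong: continuous_on_cong)
  qed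
  {
    case 0
    then show ?case using cont by simp
  next
    case (Suc n)
    have "(\<forall>x\<in>U. (\<lambda>t. f (x + t *\<^sub>R v)) differentiable (at 0)) \<and> Ck_on n (partial v f) U"
      if "v \<in> Basis" for v
    proof -
      obtain k where v: "\<And>x t. offset1 a (x + t *\<^sub>R v) = (offset1 a x)(k := offset1 a x k + t)"
      proof -
        have "v = (1, 0) \<or> (\<exists>j. v = (0, axis j 1))"
          using \<open>v \<in> Basis\<close> by (auto simp: Basis_prod_def Basis_vec_def)
        then show thesis
          using that offset1_axis by metis
      qed
      show ?thesis
        using has_expansion_derivative[OF Suc.prems _ v] Suc.IH[OF has_expansion_partial[OF Suc.prems v]]
        by (auto intro: differentiableI_vector)
    qed
    then show ?case
      using cont[OF Suc.prems] by simp
  }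
qed

lemma Ck_on_local:
  assumes "\<And>x. x \<in> S \<Longrightarrow> \<exists>V. open V \<and> x \<in> V \<and> Ck_on n f V"
  shows "Ck_on n f S"
proof -
  have cont: "continuous_on S f" if "\<And>x. x \<in> S \<Longrightarrow> \<exists>V. open V \<and> x \<in> V \<and> continuous_on V f"
    for f :: "'a \<Rightarrow> real" and S
    using that by (meson continuous_at_imp_continuous_on continuous_on_eq_continuous_at)
  show ?thesis
    using assms
  proof (induction n arbitrary: f)
    case 0
    then show ?case by (simp add: cont)
  next
    case (Suc n)
    have "continuous_on S f"
    proof (rule cont)
      show "\<exists>V. open V \<and> x \<in> V \<and> continuous_on V f" if "x \<in> S" for x
        using Suc.prems[OF that] by auto
    qed
    moreover have "Ck_on n (partial v f) S" if "v \<in> Basis" for v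
    proof (rule Suc.IH)
      show "\<exists>V. open V \<and> x \<in> V \<and> Ck_on n (partial v f) V" if "x \<in> S" for x
        using Suc.prems[OF that] \<open>v \<in> Basis\<close> by auto
    qed
    moreover have "(\<lambda>t. f (x + t *\<^sub>R v)) differentiable (at 0)" if "v \<in> Basis" "x \<in> S" for v x
      using Suc.prems[OF that(2)] that(1) by auto
    ultimately show ?case by simp
  qed
qed

text \<open>
  The components have expansions on balls; the smallest of these balls contains a closed box about
  \<open>a\<close>.  Summability at the corner $a + (\rho, \dots, \rho)$ is absolute since the terms are real, and
  it is exactly the bound required of the coefficients.
\<close>
lemma clifford_analytic_on_has_expansion:
  fixes f :: "'n::finite Rm \<Rightarrow> 'm::finite clifford"
  assumes "clifford_analytic_on f S" "a \<in> S"
  obtains r where "0 < r"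
    "\<And>\<rho>. 0 < \<rho> \<Longrightarrow> \<rho> \<le> r \<Longrightarrow> \<exists>c M. majorized \<rho> c M \<and>
      has_expansion f {x. \<forall>i. \<bar>offset a x i\<bar> < \<rho>} (offset a) \<rho> c"
proof -
  define P where "P A r c \<longleftrightarrow> (\<forall>x\<in>ball a r. ((\<lambda>\<alpha>. c \<alpha> * (\<Prod>i\<in>UNIV. (x $ i - a $ i) ^ \<alpha> i))
      has_sum f x $ A) UNIV)" for A r and c :: "('n \<Rightarrow> nat) \<Rightarrow> real"
  have "\<forall>A. \<exists>r. 0 < r \<and> (\<exists>c. P A r c)"
    using assms unfolding clifford_analytic_on_def real_analytic_on_def P_def by blast
  then obtain R and c :: "'m set \<Rightarrow> ('n \<Rightarrow> nat) \<Rightarrow> real"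
    where R: "\<And>A. 0 < R A" and "\<And>A. P A (R A) (c A)"
    by metis
  then have c: "((\<lambda>\<alpha>. c A \<alpha> * (\<Prod>i\<in>UNIV. (x $ i - a $ i) ^ \<alpha> i)) has_sum f x $ A) UNIV"
    if "x \<in> ball a (R A)" for A x
    using that unfolding P_def by blast
  define R0 where "R0 = Min (range R)"
  have R0: "0 < R0" "\<And>A. R0 \<le> R A"
    unfolding R0_def using R by (auto simp: Min_gr_iff)
  define r where "r = R0 / (real CARD('n) + 1)"
  define C :: "('n \<Rightarrow> nat) \<Rightarrow> 'm clifford" where "C \<alpha> = (\<chi> A. c A \<alpha>)" for \<alpha>
  have sum: "((\<lambda>\<alpha>. c A \<alpha> * monomial (offset a x) \<alpha>) has_sum f x $ A) UNIV"
    if "\<And>i. \<bar>offset a x i\<bar> \<le> r" for A x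
  proof -
    have "x \<in> ball a R0"
      using that R0(1) by (intro offset_le_imp_mem_ball[of a x r]) (auto simp: r_def)
    then have "x \<in> ball a (R A)"
      using R0(2)[of A] by auto
    then show ?thesis
      using c by (simp add: monomial_def offset_def)
  qed
  have "0 < r"
    using R0 by (simp add: r_def add_pos_pos)
  moreover have "\<exists>c M. majorized \<rho> c M \<and>
      has_expansion f {x. \<forall>i. \<bar>offset a x i\<bar> < \<rho>} (offset a) \<rho> c" if \<rho>: "0 < \<rho>" "\<rho> \<le> r" for \<rho>
  proof -
    have "(\<lambda>\<alpha>. norm (c A \<alpha>) * \<rho> ^ sum \<alpha> UNIV) summable_on UNIV" for A
    proof -
      \<comment> \<open>At this corner every monomial takes its maximal value $\rho^{|\alpha|}$ on the box.\<close>
      let ?x = "a + (\<chi> i. \<rho>)"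
      have "monomial (offset a ?x) \<alpha> = \<rho> ^ sum \<alpha> UNIV" for \<alpha>
        by (simp add: monomial_def offset_def power_sum)
      then have "(\<lambda>\<alpha>. c A \<alpha> * \<rho> ^ sum \<alpha> UNIV) summable_on UNIV"
        using sum[of ?x A] \<rho> by (auto simp: summable_on_def offset_def)
      then have "(\<lambda>\<alpha>. norm (c A \<alpha> * \<rho> ^ sum \<alpha> UNIV)) summable_on UNIV"
        by (rule summable_on_iff_abs_summable_on_real[THEN iffD1])
      then show ?thesis
        using \<rho> by (simp add: abs_mult)
    qed
    then obtain s where s: "\<And>A. ((\<lambda>\<alpha>. norm (c A \<alpha>) * \<rho> ^ sum \<alpha> UNIV) has_sum s A) UNIV"
      unfolding summable_on_def by metis
    have maj: "majorized \<rho> C (\<Sum>A\<in>UNIV. s A)"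
    proof (rule majorizedI)
      fix F :: "('n \<Rightarrow> nat) set"
      assume F: "finite F"
      have "(\<Sum>\<alpha>\<in>F. norm (C \<alpha>) * \<rho> ^ sum \<alpha> UNIV) \<le>
          (\<Sum>\<alpha>\<in>F. (\<Sum>A\<in>UNIV. norm (c A \<alpha>)) * \<rho> ^ sum \<alpha> UNIV)"
        using \<rho> by (intro sum_mono mult_right_mono)
          (auto simp: C_def intro: order_trans[OF norm_le_l1_cart])
      also have "\<dots> = (\<Sum>A\<in>UNIV. \<Sum>\<alpha>\<in>F. norm (c A \<alpha>) * \<rho> ^ sum \<alpha> UNIV)"
        unfolding sum_distrib_right by (rule sum.swap)
      also have "\<dots> \<le> (\<Sum>A\<in>UNIV. s A)"
        using F s \<rho> by (intro sum_mono finite_sum_le_has_sum) auto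
      finally show "(\<Sum>\<alpha>\<in>F. norm (C \<alpha>) * \<rho> ^ sum \<alpha> UNIV) \<le> (\<Sum>A\<in>UNIV. s A)" .
    qed
    have "f x = power_series C (offset a x)" if "\<forall>i. \<bar>offset a x i\<bar> < \<rho>" for x
    proof -
      have *: "((\<lambda>\<alpha>. monomial (offset a x) \<alpha> *\<^sub>R C \<alpha>) has_sum power_series C (offset a x)) UNIV"
        using that by (intro power_series_has_sum[OF majorized_imp_convergent_below[OF maj]]) auto
      have "f x $ A = power_series C (offset a x) $ A" for A
      proof (rule has_sum_unique)
        show "((\<lambda>\<alpha>. c A \<alpha> * monomial (offset a x) \<alpha>) has_sum f x $ A) UNIV"
          using that \<rho> by (intro sum) (meson less_imp_le less_le_trans)
        show "((\<lambda>\<alpha>. c A \<alpha> * monomial (offset a x) \<alpha>) has_sum power_series C (offset a x) $ A) UNIV"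
          using has_sum_bounded_linear[OF bounded_linear_vec_nth *] by (simp add: C_def mult.commute)
      qed
      then show ?thesis
        by (simp add: vec_eq_iff)
    qed
    then show ?thesis
      using maj open_offset_box majorized_imp_convergent_below[OF maj] unfolding has_expansion_def by blast
  qed
  ultimately show ?thesis
    using that by blast
qed

section \<open>The Cauchy--Kovalevskaya series near a point\<close>
definition slab_box :: "'m Rm \<Rightarrow> real \<Rightarrow> 'm::finite Rm1 set" where
  "slab_box a \<delta> = {p. \<forall>k. \<bar>offset1 a p k\<bar> < \<delta>}"

lemma slab_box_iff: "p \<in> slab_box a \<delta> \<longleftrightarrow> \<bar>fst p\<bar> < \<delta> \<and> (\<forall>i. \<bar>offset a (snd p) i\<bar> < \<delta>)"
  by (auto simp: slab_box_def offset1_def split: option.splits)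

lemma open_slab_box: "open (slab_box a \<delta>)"
proof -
  have "continuous_on UNIV (\<lambda>y. offset1 a y k)" for k
    by (cases k) (auto simp: offset1_def offset_def intro!: continuous_intros)
  then show ?thesis
    unfolding slab_box_def Collect_all_eq
    by (intro open_INT ballI open_Collect_less continuous_intros) auto
qed

text \<open>
  The sign of $g_n$ is $(-1)^{n+1}$, that of $(-x_0)^n$ is $(-1)^n$; this is why the series
  enters with a minus sign.
\<close>
lemma CK_term_eq:
  assumes A0: "has_expansion A0 U (offset a) \<rho> c0" and A1: "has_expansion A1 U (offset a) \<rho> c1"
    and x: "snd p \<in> U"
  shows "CK_term A0 A1 p (n + 2) = - ((fst p ^ (n + 2) / fact (n + 2)) *\<^sub>R
    power_series (CK_coeffs c0 c1 (n + 2)) (offset a (snd p)))"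
proof -
  let ?S = "\<lambda>c. power_series c (offset a (snd p))"
  note E0 = has_expansion_dirac_pow[OF A0] and E1 = has_expansion_dirac_pow[OF A1]
  have "has_expansion (\<lambda>x. (\<Sum>j<n + 1. dirac_pow (n + 1 - j) (j + 1) A0 x) +
        (\<Sum>j<n + 2. dirac_pow (n + 2 - j - 1) j A1 x)) U (offset a) \<rho>
      (\<lambda>\<alpha>. coeff_dirac_right (coeff_dirac_left (coeff_dirac_hom (n + 1) c0)) \<alpha> +
        coeff_dirac_hom (n + 2) c1 \<alpha>)"
    unfolding coeff_dirac_right_left_hom coeff_dirac_hom_def
    by (intro has_expansion_add has_expansion_sum E0 E1) auto
  from has_expansion_linear[OF this bounded_linear_scaleR_right[of "(- 1) ^ Suc (n + 2)"]]
  have "?S (CK_coeffs c0 c1 (n + 2)) = (- 1) ^ Suc (n + 2) *\<^sub>R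
      ((\<Sum>j<n + 1. dirac_pow (n + 1 - j) (j + 1) A0 (snd p)) +
        (\<Sum>j<n + 2. dirac_pow (n + 2 - j - 1) j A1 (snd p)))"
    using x by (auto simp: CK_coeffs_def has_expansion_def)
  moreover have "{0..n + 2 - 2} = {..<n + 1}" "{0..n + 2 - 1} = {..<n + 2}"
    by auto
  moreover have "(- fst p) ^ (n + 2) = (- 1) ^ n * fst p ^ (n + 2)"
    by (simp add: power_minus[of "fst p"])
  ultimately show ?thesis
    unfolding CK_term_def by (simp add: mult_ac)
qed

text \<open>
  All data are expanded at \<open>a\<close> with a common radius $\rho$; then $\delta$ is chosen below $\rho / 2$,
  where the $g_n$ are controlled, and so small that $\sum_n \delta^n |g_n| / n!$ is dominated by a
  geometric series.
\<close>
lemma CK_local: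
  fixes A0 A1 :: "'m::{finite,linorder} Rm \<Rightarrow> 'm clifford"
  assumes "open \<Omega>" "a \<in> \<Omega>" "clifford_analytic_on A0 \<Omega>" "clifford_analytic_on A1 \<Omega>"
  obtains \<delta> c0 c1 where "0 < \<delta>" "\<And>x. (\<And>i. \<bar>offset a x i\<bar> < \<delta>) \<Longrightarrow> x \<in> \<Omega>"
    "has_expansion A1 {x. \<forall>i. \<bar>offset a x i\<bar> < \<delta>} (offset a) \<delta> c1"
    "has_expansion (CK A0 A1) (slab_box a \<delta>) (offset1 a) \<delta> (exp_coeffs (CK_coeffs c0 c1))"
    "\<And>p. p \<in> slab_box a \<delta> \<Longrightarrow> summable (\<lambda>n. CK_term A0 A1 p (n + 2))"
proof -
  obtain r0 where r0: "0 < r0" "\<And>\<rho>. 0 < \<rho> \<Longrightarrow> \<rho> \<le> r0 \<Longrightarrow> \<exists>c M. majorized \<rho> c M \<and>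
      has_expansion A0 {x. \<forall>i. \<bar>offset a x i\<bar> < \<rho>} (offset a) \<rho> c"
    using clifford_analytic_on_has_expansion[OF assms(3,2)] by blast
  obtain r1 where r1: "0 < r1" "\<And>\<rho>. 0 < \<rho> \<Longrightarrow> \<rho> \<le> r1 \<Longrightarrow> \<exists>c M. majorized \<rho> c M \<and>
      has_expansion A1 {x. \<forall>i. \<bar>offset a x i\<bar> < \<rho>} (offset a) \<rho> c"
    using clifford_analytic_on_has_expansion[OF assms(4,2)] by blast
  obtain e where e: "0 < e" "ball a e \<subseteq> \<Omega>"
    using assms(1,2) open_contains_ball by blast
  define \<rho> where "\<rho> = Min {r0, r1, e / (real CARD('m) + 1)}"
  have \<rho>: "0 < \<rho>" "\<rho> \<le> r0" "\<rho> \<le> r1" "\<rho> \<le> e / (real CARD('m) + 1)"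
    unfolding \<rho>_def using r0 r1 e by (auto simp: add_pos_pos)
  obtain c0 M0 where c0: "majorized \<rho> c0 M0"
    "has_expansion A0 {x. \<forall>i. \<bar>offset a x i\<bar> < \<rho>} (offset a) \<rho> c0"
    using r0(2) \<rho> by blast
  obtain c1 M1 where c1: "majorized \<rho> c1 M1"
    "has_expansion A1 {x. \<forall>i. \<bar>offset a x i\<bar> < \<rho>} (offset a) \<rho> c1"
    using r1(2) \<rho> by blast
  define M where "M = max M0 M1"
  have "majorized \<rho> c0 M" "majorized \<rho> c1 M" "0 \<le> M"
    using majorized_mono[OF c0(1)] majorized_mono[OF c1(1)] majorized_nonneg[OF c0(1)] \<rho>
    by (auto simp: M_def)
  obtain Q where Q: "1 \<le> Q" "\<And>n M (a :: ('m \<Rightarrow> nat) \<Rightarrow> 'm clifford) b.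
      majorized \<rho> a M \<Longrightarrow> majorized \<rho> b M \<Longrightarrow>
      majorized (\<rho> / 2) (CK_coeffs a b n) (M * fact n * Q ^ n)"
    using CK_coeffs_majorized[OF \<rho>(1)] by metis
  \<comment> \<open>The second bound keeps the ratio $\delta Q$ of the geometric majorant at most $1/2$.\<close>
  define \<delta> where "\<delta> = min (\<rho> / 2) (1 / (2 * Q))"
  have \<delta>: "0 < \<delta>" "\<delta> \<le> \<rho> / 2" "\<delta> * Q \<le> 1 / 2" "\<delta> \<le> \<rho>"
    using \<rho> Q(1) by (auto simp: \<delta>_def min_def field_simps)
  let ?g = "CK_coeffs c0 c1"
  have g: "majorized \<delta> (?g n) (M * fact n * Q ^ n)" for n
    using \<open>majorized \<rho> c0 M\<close> \<open>majorized \<rho> c1 M\<close> \<delta> by (intro majorized_mono[OF Q(2)]) auto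
  have "(\<Sum>n\<le>N. \<delta> ^ n / fact n * (M * fact n * Q ^ n)) \<le> M * 2" for N
  proof -
    have "(\<Sum>n\<le>N. \<delta> ^ n / fact n * (M * fact n * Q ^ n)) = M * (\<Sum>n\<le>N. (\<delta> * Q) ^ n)"
      by (simp add: sum_distrib_left power_mult_distrib mult_ac)
    also have "\<dots> \<le> M * (\<Sum>n\<le>N. (1 / 2) ^ n)"
      using \<delta> Q \<open>0 \<le> M\<close> by (intro mult_left_mono sum_mono power_mono) auto
    also have "\<dots> \<le> M * 2"
      using \<open>0 \<le> M\<close> sum_le_suminf[of "\<lambda>n. (1 / 2 :: real) ^ n" "{..N}"] suminf_geometric[of "1 / 2 :: real"]
      by (intro mult_left_mono) (auto simp: summable_geometric)
    finally show ?thesis .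
  qed
  then have conv: "convergent_below \<delta> (exp_coeffs ?g)"
    using g \<delta> by (intro majorized_imp_convergent_below majorized_exp_coeffs[of \<delta> ?g]) auto
  have mono: "has_expansion f {x. \<forall>i. \<bar>offset a x i\<bar> < \<delta>} (offset a) \<delta> c"
    if "has_expansion f {x. \<forall>i. \<bar>offset a x i\<bar> < \<rho>} (offset a) \<rho> c"
    for f :: "'m Rm \<Rightarrow> 'm clifford" and c
  proof -
    have "convergent_below \<delta> c"
      using has_expansionD(2)[OF that] \<delta>(4) unfolding convergent_below_def by auto
    moreover have "f x = power_series c (offset a x)" if "\<forall>i. \<bar>offset a x i\<bar> < \<delta>" for x
    proof -
      have "\<bar>offset a x i\<bar> < \<rho>" for i
        using that \<delta>(4) less_le_trans by blast
      then show ?thesis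
        using has_expansionD(4)[OF \<open>has_expansion f _ _ \<rho> c\<close>] by simp
    qed
    ultimately show ?thesis
      unfolding has_expansion_def using open_offset_box by blast
  qed
  note A0 = mono[OF c0(2)] and A1 = mono[OF c1(2)]
  have "x \<in> \<Omega>" if "\<And>i. \<bar>offset a x i\<bar> < \<delta>" for x
  proof -
    have "x \<in> ball a e"
      using less_le_trans[OF that \<delta>(4)] \<rho>(4) e(1)
      by (intro offset_le_imp_mem_ball[of a x \<rho>]) (auto intro: less_imp_le)
    then show ?thesis
      using e(2) by blast
  qed
  moreover have CK: "CK A0 A1 p = power_series (exp_coeffs ?g) (offset1 a p) \<and>
      summable (\<lambda>n. CK_term A0 A1 p (n + 2))" if "p \<in> slab_box a \<delta>" for p
  proof -
    let ?u = "\<lambda>n. (fst p ^ n / fact n) *\<^sub>R power_series (?g n) (offset a (snd p))"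
    have p: "\<bar>fst p\<bar> < \<delta>" "snd p \<in> {x. \<forall>i. \<bar>offset a x i\<bar> < \<delta>}"
      using that by (auto simp: slab_box_iff)
    have sums: "?u sums power_series (exp_coeffs ?g) (offset1 a p)"
      unfolding offset1_def using p g conv
      by (intro power_series_exp_coeffs) (auto intro: majorized_imp_convergent_below)
    \<comment> \<open>The terms $n = 0, 1$ are $A_0$ and $x_0 A_1$; splitting them off leaves the series in
      the definition of \<open>CK\<close>.\<close>
    have "(\<Sum>n<2. ?u n) = A0 (snd p) + fst p *\<^sub>R A1 (snd p)"
      using has_expansionD(4)[OF A0 p(2)] has_expansionD(4)[OF A1 p(2)]
      by (simp add: numeral_2_eq_2)
    then have "(\<lambda>n. ?u (n + 2)) sums
        (power_series (exp_coeffs ?g) (offset1 a p) - (A0 (snd p) + fst p *\<^sub>R A1 (snd p)))"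
      using sums_split_initial_segment[OF sums, of 2] by (simp only:)
    then have "(\<lambda>n. CK_term A0 A1 p (n + 2)) sums
        - (power_series (exp_coeffs ?g) (offset1 a p) - (A0 (snd p) + fst p *\<^sub>R A1 (snd p)))"
      unfolding CK_term_eq[OF A0 A1 p(2)] by (rule sums_minus)
    then show ?thesis
      by (auto simp: CK_def sums_iff)
  qed
  moreover have "has_expansion (CK A0 A1) (slab_box a \<delta>) (offset1 a) \<delta> (exp_coeffs ?g)"
    unfolding has_expansion_def using CK conv open_slab_box by (auto simp: slab_box_def)
  ultimately show ?thesis
    using that[of \<delta> c1 c0] A1 \<delta>(1) by blast
qed

section \<open>The neighbourhood and the theorem\<close>
text \<open>
  On the line through a point with spatial part $\underline x$, each box cuts out either nothing or
  the interval $(-\delta_a, \delta_a)$.  These intervals all contain $0$, so their union is connected.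
\<close>
lemma x0_normal_nbhd_Union_slab_box:
  assumes "\<And>a. a \<in> \<Omega> \<Longrightarrow> 0 < \<delta> a" "\<And>a x. a \<in> \<Omega> \<Longrightarrow> (\<And>i. \<bar>offset a x i\<bar> < \<delta> a) \<Longrightarrow> x \<in> \<Omega>"
  shows "x0_normal_nbhd \<Omega> (\<Union>a\<in>\<Omega>. slab_box a (\<delta> a))"
proof -
  let ?U = "\<Union>a\<in>\<Omega>. slab_box a (\<delta> a)"
  have lines: "connected (range (\<lambda>t. p + (t, 0)) \<inter> ?U) \<and>
      (\<exists>!y. y \<in> (range (\<lambda>t. p + (t, 0)) \<inter> ?U) \<inter> ({0} \<times> \<Omega>))" if "p \<in> ?U" for p
  proof -
    obtain x0 x where p: "p = (x0, x)"
      by (cases p)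
    define J where "J = (\<Union>a\<in>{a\<in>\<Omega>. \<forall>i. \<bar>offset a x i\<bar> < \<delta> a}. {- \<delta> a <..< \<delta> a})"
    have line: "range (\<lambda>t. p + (t, 0)) \<inter> ?U = (\<lambda>t. (t, x)) ` J"
    proof -
      have "range (\<lambda>t. p + (t, 0)) = range (\<lambda>t. (t, x))"
      proof (intro equalityI subsetI; elim rangeE)
        fix q and t :: real assume "q = (t, x)"
        then have "q = p + (t - x0, 0)"
          by (simp add: p)
        then show "q \<in> range (\<lambda>t. p + (t, 0))"
          by blast
      qed (auto simp: p)
      moreover have "(t, x) \<in> ?U \<longleftrightarrow> t \<in> J" for t
        by (force simp: J_def slab_box_iff abs_less_iff)
      ultimately show ?thesis
        by (simp only:) blast
    qed
    have "connected J"
      unfolding J_def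
    proof (rule connected_Union)
      have "0 \<in> \<Inter> ((\<lambda>a. {- \<delta> a <..< \<delta> a}) ` {a\<in>\<Omega>. \<forall>i. \<bar>offset a x i\<bar> < \<delta> a})"
        using assms(1) by simp
      then show "\<Inter> ((\<lambda>a. {- \<delta> a <..< \<delta> a}) ` {a\<in>\<Omega>. \<forall>i. \<bar>offset a x i\<bar> < \<delta> a}) \<noteq> {}"
        by blast
    qed auto
    then have "connected ((\<lambda>t. (t, x)) ` J)"
      by (intro connected_continuous_image continuous_intros)
    moreover have "0 \<in> J" "x \<in> \<Omega>"
      using that assms by (auto simp: J_def p slab_box_iff)
    then have "\<exists>!y. y \<in> (\<lambda>t. (t, x)) ` J \<inter> ({0} \<times> \<Omega>)"
      by (intro ex1I[of _ "(0, x)"]) auto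
    ultimately show ?thesis
      unfolding line by blast
  qed
  have op: "open ?U"
    by (intro open_UN ballI open_slab_box)
  have sub: "{0} \<times> \<Omega> \<subseteq> ?U"
    using assms(1) by (force simp: slab_box_iff offset_def)
  show ?thesis
    unfolding x0_normal_nbhd_def
    by (intro conjI ballI op sub lines[THEN conjunct1] lines[THEN conjunct2])
qed

theorem theorem1:
  fixes \<Omega> :: "'m::{finite,linorder} Rm set"
    and A0 A1 :: "'m Rm \<Rightarrow> 'm clifford"
  assumes "open \<Omega>" and "connected \<Omega>"
    and "clifford_analytic_on A0 \<Omega>" and "clifford_analytic_on A1 \<Omega>"
  shows "\<exists>\<Omega>'. x0_normal_nbhd \<Omega> \<Omega>' \<and>
    (\<forall>x\<in>\<Omega>'. summable (\<lambda>n. CK_term A0 A1 x (n + 2))) \<and>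
    inframonogenic_on (CK A0 A1) \<Omega>' \<and>
    (\<forall>x\<in>\<Omega>. CK A0 A1 (0, x) = A0 x) \<and>
    (\<forall>x\<in>\<Omega>. partial (1, 0) (CK A0 A1) (0, x) = A1 x)"
proof -
  define local_solution where "local_solution a \<delta> c0 c1 \<longleftrightarrow> 0 < \<delta> \<and>
    (\<forall>x. (\<forall>i. \<bar>offset a x i\<bar> < \<delta>) \<longrightarrow> x \<in> \<Omega>) \<and>
    has_expansion A1 {x. \<forall>i. \<bar>offset a x i\<bar> < \<delta>} (offset a) \<delta> c1 \<and>
    has_expansion (CK A0 A1) (slab_box a \<delta>) (offset1 a) \<delta> (exp_coeffs (CK_coeffs c0 c1)) \<and>
    (\<forall>p\<in>slab_box a \<delta>. summable (\<lambda>n. CK_term A0 A1 p (n + 2)))" for a \<delta> c0 c1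
  have "\<forall>a\<in>\<Omega>. \<exists>\<delta> c0 c1. local_solution a \<delta> c0 c1"
    unfolding local_solution_def
    by (intro ballI, rule CK_local[OF assms(1) _ assms(3,4)]) blast+
  then obtain \<delta> c0 c1 where local: "local_solution a (\<delta> a) (c0 a) (c1 a)" if "a \<in> \<Omega>" for a
    by metis
  have \<delta>: "0 < \<delta> a"
    and \<Omega>: "(\<And>i. \<bar>offset a x i\<bar> < \<delta> a) \<Longrightarrow> x \<in> \<Omega>"
    and A1: "has_expansion A1 {x. \<forall>i. \<bar>offset a x i\<bar> < \<delta> a} (offset a) (\<delta> a) (c1 a)"
    and CK: "has_expansion (CK A0 A1) (slab_box a (\<delta> a)) (offset1 a) (\<delta> a)
      (exp_coeffs (CK_coeffs (c0 a) (c1 a)))"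
    and summable: "p \<in> slab_box a (\<delta> a) \<Longrightarrow> summable (\<lambda>n. CK_term A0 A1 p (n + 2))"
    if "a \<in> \<Omega>" for a x p
    using local[OF that] unfolding local_solution_def by simp_all
  define \<Omega>' where "\<Omega>' = (\<Union>a\<in>\<Omega>. slab_box a (\<delta> a))"
  have normal: "x0_normal_nbhd \<Omega> \<Omega>'"
    unfolding \<Omega>'_def using \<delta> \<Omega> by (rule x0_normal_nbhd_Union_slab_box)
  have "clifford_Ck_on 2 (CK A0 A1) \<Omega>'"
    unfolding clifford_Ck_on_def
  proof (intro allI Ck_on_local)
    fix A p assume "p \<in> \<Omega>'"
    then obtain a where a: "a \<in> \<Omega>" "p \<in> slab_box a (\<delta> a)"
      by (auto simp: \<Omega>'_def)
    then show "\<exists>V. open V \<and> p \<in> V \<and> Ck_on 2 (\<lambda>p. CK A0 A1 p $ A) V"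
      using has_expansion_Ck_on[OF has_expansion_linear[OF CK[OF a(1)] bounded_linear_vec_nth]]
        open_slab_box by blast
  qed
  moreover have "cr_right (cr_left (CK A0 A1)) p = 0" if "p \<in> \<Omega>'" for p
  proof -
    obtain a where a: "a \<in> \<Omega>" "p \<in> slab_box a (\<delta> a)"
      using \<open>p \<in> \<Omega>'\<close> by (auto simp: \<Omega>'_def)
    let ?g = "CK_coeffs (c0 a) (c1 a)"
    \<comment> \<open>Applying \<open>shift + L\<close> and then \<open>shift + R\<close> to the sequence gives the left-hand side of
      the recursion.\<close>
    have "(\<lambda>n \<alpha>. (?g (Suc (Suc n)) \<alpha> + coeff_dirac_left (?g (Suc n)) \<alpha>) +
        coeff_dirac_right (\<lambda>\<alpha>. ?g (Suc n) \<alpha> + coeff_dirac_left (?g n) \<alpha>) \<alpha>) = (\<lambda>n \<alpha>. 0)"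
      using CK_coeffs_rec[of "c0 a" "c1 a"] by (simp add: coeff_dirac_add add.assoc)
    moreover have "exp_coeffs (\<lambda>n (\<alpha> :: 'm \<Rightarrow> nat). 0) = (\<lambda>\<beta>. 0 :: 'm clifford)"
      by (simp add: exp_coeffs_def fun_eq_iff)
    ultimately show ?thesis
      using has_expansionD(4)[OF has_expansion_cr(2)[OF has_expansion_cr(1)[OF CK[OF a(1)]]] a(2)]
      by (simp add: power_series_zero)
  qed
  moreover have "CK A0 A1 (0, x) = A0 x" for x
    by (simp add: CK_def CK_term_def)
  moreover have "partial (1, 0) (CK A0 A1) (0, x) = A1 x" if x: "x \<in> \<Omega>" for x
  proof -
    let ?g = "CK_coeffs (c0 x) (c1 x)"
    have x0: "(0, x) \<in> slab_box x (\<delta> x)"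
      using \<delta>[OF x] by (simp add: slab_box_iff offset_def)
    have D: "has_expansion (partial (1, 0) (CK A0 A1)) (slab_box x (\<delta> x)) (offset1 x) (\<delta> x)
        (exp_coeffs (\<lambda>n. ?g (Suc n)))"
      using has_expansion_partial[OF CK[OF x] offset1_axis(1)] by (simp add: coeff_deriv_exp_coeffs_None)
    \<comment> \<open>The value of a power series at its centre is its constant coefficient, and for the
      shifted sequence that of $g_1 = A_1$.\<close>
    have center: "offset1 x (0, x) = (\<lambda>k. 0)" "offset x x = (\<lambda>i. 0)"
      by (auto simp: offset1_def offset_def fun_eq_iff split: option.split)
    have "partial (1, 0) (CK A0 A1) (0, x) = power_series (exp_coeffs (\<lambda>n. ?g (Suc n))) (\<lambda>k. 0)"
      using has_expansionD(4)[OF D x0] by (simp add: center)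
    also have "\<dots> = power_series (c1 x) (\<lambda>i. 0)"
      by (simp add: power_series_at_0 exp_coeffs_def)
    also have "\<dots> = A1 x"
      using has_expansionD(4)[OF A1[OF x], of x] \<delta>[OF x] by (simp add: center)
    finally show ?thesis .
  qed
  moreover have "open \<Omega>'"
    using normal by (simp add: x0_normal_nbhd_def)
  moreover have "summable (\<lambda>n. CK_term A0 A1 p (n + 2))" if "p \<in> \<Omega>'" for p
  proof -
    obtain a where "a \<in> \<Omega>" "p \<in> slab_box a (\<delta> a)"
      using \<open>p \<in> \<Omega>'\<close> by (auto simp: \<Omega>'_def)
    then show ?thesis
      by (rule summable)
  qed
  ultimately show ?thesis
    using normal unfolding inframonogenic_on_def by (intro exI[of _ \<Omega>'] conjI ballI)
qed

end
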